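(* Let $\rho_1,\rho_2:W_F\to\mathrm{GL}_2(\overline{\mathbb{Q}}_\ell)$ be a supercuspidal representation and a special representation, respectively, such that $\rho_1(W_F),\rho_2(W_F)\subset\mathrm{GL}_2(\mathcal{O}_K)$, with associated Weil--Deligne representations $\mathrm{Ind}_{W_E}^{W_F}\xi$ and $\chi\omega\oplus\chi$, where $E/F$ is a quadratic extension, $\xi$ is a $1$-dimensional representation of $W_E$ and $\chi$ is a $1$-dimensional representation of $W_F$. Suppose (as may be assumed without loss of generality) that there are upper triangular matrices $U_j=\begin{pmatrix}a_j&b_j\\0&d_j\end{pmatrix}\in\mathrm{GL}_2(K)$, $j=1,2$, such that for all $k\in\mathbb{Z}$, $\tau\in I_F$, $$\rho_1(\Phi^k\tau)=U_1\,\mathrm{Ind}_{W_E}^{W_F}\xi(\Phi^k\tau)\,U_1^{-1},$$ $$\rho_2(\Phi^k\tau)=\begin{pmatrix}\chi\omega(\Phi^k\tau)&\frac{a_2}{d_2}t_\ell(\tau)\chi\omega(\Phi^k\tau)+\frac{b_2}{d_2}(\chi(\Phi^k\tau)-\chi\omega(\Phi^k\tau))\\0&\chi(\Phi^k\tau)\end{pmatrix}.$$ Suppose that $a_2/d_2\in\mathcal{O}_K^\times$ and that $E/F$ is unramified. Then $\overline{\rho}_1\cong\overline{\rho}_2$ if and only if $\overline{\rho}_2$ is indecomposable, $q\equiv-1\pmod{\ell}$, $\overline{\chi}|_{W_E}=\overline{\xi}$, $\chi(\sigma)\equiv-\frac{a_1}{b_1}\pmod{\lambda}$ (in particular $b_1\neq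 0$), and there exists $x\in\mathcal{O}_K^\times$ such that $$\frac{a_2x}{d_2}t_\ell(h)\chi(h)\equiv\frac{b_1}{d_1}\bigl(\xi^\sigma(h)-\xi(h)\bigr)\pmod{\lambda}$$ for all $h\in W_E$, where $t_\ell(h)$ denotes the image under $t_\ell$ of the inertial part of $h$, i.e. $t_\ell(\Phi^k\tau):=t_\ell(\tau)$.
   Context: $p\neq\ell$ are odd primes. $F/\mathbb{Q}_p$ is a finite extension with residue field of order $q$, Weil group $W_F$ and inertia group $I_F$. $\Phi\in W_F$ is a fixed Frobenius element, and $\omega$ is the character of $W_F$ with $\omega(\Phi^k\tau)=q^{-k}$ for $k\in\mathbb{Z}$, $\tau\in I_F$. $t_\ell:I_F\to\mathbb{Z}_\ell$ is a fixed continuous surjective homomorphism; it satisfies $t_\ell(g\tau g^{-1})=\omega(g)t_\ell(\tau)$. $K/\mathbb{Q}_\ell$ is a finite extension with ring of integers $\mathcal{O}_K$ and maximal ideal $\lambda$. A bar denotes reduction modulo $\lambda$. All representations are continuous. For a quadratic extension $E/F$, $W_E\subset W_F$ has index $2$, $\sigma\in W_F\setminus W_E$ is a fixed element, $\xi^\sigma(h)=\xi(\sigma h\sigma^{-1})$, and $\mathrm{Ind}_{W_E}^{W_F}\xi$ denotes the matrix representation given for $h\in W_E$ by $$h\mapsto\begin{pmatrix}\xi(h)&0\\0&\xi^\sigma(h)\end{pmatrix},\qquad h\sigma\mapsto\begin{pmatrix}0&\xi(h)\\ \xi(\sigma h\sigma)&0\end{pmatrix}.$$ The Weil--Deligne representation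 associated with a continuous $\rho$ is $(\rho_\Phi,N_\rho)$, where $N_\rho$ is the unique nilpotent matrix with $\rho(\tau)=\exp(t_\ell(\tau)N_\rho)$ for $\tau$ in some open subgroup of $I_F$, and $\rho_\Phi(\Phi^k\tau)=\rho(\Phi^k\tau)\exp(-t_\ell(\tau)N_\rho)$. $\rho$ is (nonexceptional) supercuspidal if its Weil--Deligne representation is isomorphic to $(\mathrm{Ind}_{W_E}^{W_F}\xi,0)$ with $E/F$ quadratic and $\xi\neq\xi^\sigma$ (for $p$ odd all supercuspidals are of this form), and special if it is isomorphic to $\left(\chi\omega\oplus\chi,\begin{pmatrix}0&1\\0&0\end{pmatrix}\right)$. *)

theory Defs
  imports
    "HOL-Analysis.Analysis"
    "HOL-Algebra.Algebra"
    "HOL-Algebra.Algebraic_Closure_Type"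
    "HOL-Number_Theory.Cong"
begin

section \<open>p-adic fields\<close>

abbreviation fld :: "'a::field ring"
  where "fld \<equiv> ring_of_type_algebra"

definition val_ring :: "('a::field \<Rightarrow> real) \<Rightarrow> 'a set \<Rightarrow> 'a set"
  where "val_ring v L = {x \<in> L. v x \<le> 1}"

definition val_ideal :: "('a::field \<Rightarrow> real) \<Rightarrow> 'a set \<Rightarrow> 'a set"
  where "val_ideal v L = {x \<in> L. v x < 1}"

definition units_in :: "'a::field set \<Rightarrow> 'a set"
  where "units_in R = {x \<in> R. x \<noteq> 0 \<and> inverse x \<in> R}"

definition cong_val :: "('a::field \<Rightarrow> real) \<Rightarrow> 'a set \<Rightarrow> 'a \<Rightarrow> 'a \<Rightarrow> bool"
  where "cong_val v K x y \<longleftrightarrow> x - y \<in> val_ideal v K"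

definition residue_card :: "('a::field \<Rightarrow> real) \<Rightarrow> 'a set \<Rightarrow> nat"
  where "residue_card v L =
    card (val_ring v L // {(x, y). x \<in> val_ring v L \<and> y \<in> val_ring v L \<and> cong_val v L x y})"

definition val_topology :: "('a::field \<Rightarrow> real) \<Rightarrow> 'a topology"
  where "val_topology v = Metric_space.mtopology UNIV (\<lambda>x y. v (x - y))"

text \<open>
  The type \<open>'a\<close> is an algebraic closure of \<open>Q\<close>, where \<open>Q\<close> is the field of \<open>p\<close>-adic numbers, i.e. the
  completion of the rationals for the \<open>p\<close>-adic absolute value; \<open>v\<close> is the (unique) extension of
  the \<open>p\<close>-adic absolute value to \<open>'a\<close>.
\<close>
locale padic_closure =
  fixes p :: nat and Q :: "'a::alg_closed_field set" and v :: "'a \<Rightarrow> real"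
  assumes prime: "Factorial_Ring.prime p"
    and subfield_Q: "subfield Q fld"
    and v_nonneg: "v x \<ge> 0"
    and v_eq_0: "v x = 0 \<longleftrightarrow> x = 0"
    and v_mult: "v (x * y) = v x * v y"
    and v_add: "v (x + y) \<le> max (v x) (v y)"
    and v_padic: "n > 0 \<Longrightarrow> v (of_nat n) = 1 / real p ^ Factorial_Ring.multiplicity p n"
    and rat_dense: "x \<in> Q \<Longrightarrow> e > 0 \<Longrightarrow> \<exists>m n :: int. n \<noteq> 0 \<and> v (x - of_int m / of_int n) < e"
    and complete: "Metric_space.mcomplete Q (\<lambda>x y. v (x - y))"
    and algebraic_Q: "ring.algebraic fld Q x"

definition finite_extension :: "'a::field set \<Rightarrow> 'a set \<Rightarrow> bool"
  where "finite_extension F E \<longleftrightarrow>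
    subfield F fld \<and> subfield E fld \<and> F \<subseteq> E \<and> ring.finite_dimension fld F E"

definition quadratic_extension :: "'a::field set \<Rightarrow> 'a set \<Rightarrow> bool"
  where "quadratic_extension F E \<longleftrightarrow> finite_extension F E \<and> ring.dimension fld 2 F E"

text \<open>
  Ramification index one. The residue fields of the fields considered are finite, so
  separability of the residue extension is automatic.
\<close>
definition unramified :: "('a::field \<Rightarrow> real) \<Rightarrow> 'a set \<Rightarrow> 'a set \<Rightarrow> bool"
  where "unramified v F E \<longleftrightarrow> v ` E = v ` F"

section \<open>Weil groups\<close>

definition gal :: "'a::field set \<Rightarrow> ('a \<Rightarrow> 'a) set"
  where "gal F = {g \<in> ring_iso fld fld. \<forall>x\<in>F. g x = x}"

text \<open>
  \<open>g\<close> lies in the Weil group iff it induces on the residue field of the algebraic closure an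
  integral power \<open>Frob\<^sup>n\<^sup>-\<^sup>m\<close> of the map \<open>Frob x = x\<^sup>q\<close>, that is, iff
  \<open>Frob\<^sup>m \<circ> g = Frob\<^sup>n\<close> on that residue field for some naturals \<open>m\<close>, \<open>n\<close>.
\<close>
definition weil_group :: "('a::field \<Rightarrow> real) \<Rightarrow> 'a set \<Rightarrow> ('a \<Rightarrow> 'a) monoid"
  where "weil_group v F =
    \<lparr>carrier = {g \<in> gal F. \<exists>m n :: nat. \<forall>x \<in> val_ring v UNIV.
        cong_val v UNIV (g x ^ (residue_card v F ^ m)) (x ^ (residue_card v F ^ n))},
     monoid.mult = (\<circ>), one = id\<rparr>"

definition inertia_group :: "('a::field \<Rightarrow> real) \<Rightarrow> 'a set \<Rightarrow> ('a \<Rightarrow> 'a) set"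
  where "inertia_group v F = {g \<in> gal F. \<forall>x \<in> val_ring v UNIV. cong_val v UNIV (g x) x}"

text \<open>For \<open>E / F\<close> finite, \<open>W\<^sub>E\<close> is the preimage of \<open>Gal(E)\<close> in \<open>W\<^sub>F\<close>.\<close>
definition weil_subgroup :: "('a::field \<Rightarrow> real) \<Rightarrow> 'a set \<Rightarrow> 'a set \<Rightarrow> ('a \<Rightarrow> 'a) set"
  where "weil_subgroup v F E = carrier (weil_group v F) \<inter> gal E"

text \<open>
  The inertia group, with its profinite topology, is open in the Weil group: the cosets
  \<open>g (I\<^sub>F \<inter> Gal(L))\<close>, for \<open>L / F\<close> finite, form a base.
\<close>
definition weil_topology :: "('a::field \<Rightarrow> real) \<Rightarrow> 'a set \<Rightarrow> ('a \<Rightarrow> 'a) topology"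
  where "weil_topology v F = topology_generated_by
    {(\<lambda>h. g \<circ> h) ` (inertia_group v F \<inter> gal L) | g L.
       g \<in> carrier (weil_group v F) \<and> finite_extension F L}"

text \<open>
  A geometric Frobenius element: it induces the inverse of \<open>x \<mapsto> x\<^sup>q\<close>. This is the
  normalisation for which \<open>\<omega>(\<Phi>) = q\<^sup>-\<^sup>1\<close> is the cyclotomic character acting on tame inertia.
\<close>
definition frobenius_element :: "('a::field \<Rightarrow> real) \<Rightarrow> 'a set \<Rightarrow> ('a \<Rightarrow> 'a) \<Rightarrow> bool"
  where "frobenius_element v F \<Phi> \<longleftrightarrow> \<Phi> \<in> carrier (weil_group v F) \<and>
    (\<forall>x \<in> val_ring v UNIV. cong_val v UNIV (\<Phi> x ^ residue_card v F) x)"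

definition weil_elt ::
    "('a::field \<Rightarrow> real) \<Rightarrow> 'a set \<Rightarrow> ('a \<Rightarrow> 'a) \<Rightarrow> int \<Rightarrow> ('a \<Rightarrow> 'a) \<Rightarrow> ('a \<Rightarrow> 'a)"
  where "weil_elt v F \<Phi> k \<tau> = (\<Phi> [^]\<^bsub>weil_group v F\<^esub> k) \<otimes>\<^bsub>weil_group v F\<^esub> \<tau>"

definition norm_character ::
    "('a::field \<Rightarrow> real) \<Rightarrow> 'a set \<Rightarrow> ('a \<Rightarrow> 'a) \<Rightarrow> (('a \<Rightarrow> 'a) \<Rightarrow> 'l::field) \<Rightarrow> bool"
  where "norm_character v F \<Phi> \<omega> \<longleftrightarrow>
    \<omega> \<in> hom (weil_group v F) (mult_of fld) \<and>
    (\<forall>k. \<forall>\<tau> \<in> inertia_group v F.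
       \<omega> (weil_elt v F \<Phi> k \<tau>) = of_nat (residue_card v F) powi (- k))"

text \<open>The ring \<open>\<int>\<^sub>\<ell>\<close> is \<open>val_ring w Q\<close>.\<close>
definition tame_character ::
    "('a::field \<Rightarrow> real) \<Rightarrow> 'a set \<Rightarrow> ('l::field \<Rightarrow> real) \<Rightarrow> 'l set \<Rightarrow> (('a \<Rightarrow> 'a) \<Rightarrow> 'l) \<Rightarrow>
     (('a \<Rightarrow> 'a) \<Rightarrow> 'l) \<Rightarrow> bool"
  where "tame_character v F w Q \<omega> t \<longleftrightarrow>
    (\<forall>\<tau> \<in> inertia_group v F. \<forall>\<tau>' \<in> inertia_group v F. t (\<tau> \<circ> \<tau>') = t \<tau> + t \<tau>') \<and>
    t ` inertia_group v F = val_ring w Q \<and>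
    continuous_map (subtopology (weil_topology v F) (inertia_group v F)) (val_topology w) t \<and>
    (\<forall>g \<in> carrier (weil_group v F). \<forall>\<tau> \<in> inertia_group v F.
       t (g \<otimes>\<^bsub>weil_group v F\<^esub> \<tau> \<otimes>\<^bsub>weil_group v F\<^esub> inv\<^bsub>weil_group v F\<^esub> g) = \<omega> g * t \<tau>)"

section \<open>Two-by-two matrices\<close>

definition mat2 :: "'l::zero \<Rightarrow> 'l \<Rightarrow> 'l \<Rightarrow> 'l \<Rightarrow> 'l^2^2"
  where "mat2 a b c d = vector [vector [a, b], vector [c, d]]"

definition GL2_over :: "'l::field set \<Rightarrow> ('l^2^2) set"
  where "GL2_over R = {A. (\<forall>i j. A $ i $ j \<in> R) \<and> det A \<in> units_in R}"

definition GL2 :: "('l::field^2^2) monoid"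
  where "GL2 = \<lparr>carrier = GL2_over UNIV, monoid.mult = (**), one = mat 1\<rparr>"

definition mat_scale :: "'l::field \<Rightarrow> 'l^2^2 \<Rightarrow> 'l^2^2"
  where "mat_scale c A = (\<chi> i j. c * A $ i $ j)"

definition mat_power :: "'l::field^2^2 \<Rightarrow> nat \<Rightarrow> 'l^2^2"
  where "mat_power A n = (((**) A) ^^ n) (mat 1)"

definition mat_nilpotent :: "'l::field^2^2 \<Rightarrow> bool"
  where "mat_nilpotent A \<longleftrightarrow> (\<exists>n. mat_power A n = 0)"

text \<open>Exponential series; only meaningful for nilpotent \<open>A\<close>, where the index set is finite.\<close>
definition mat_exp :: "'l::field^2^2 \<Rightarrow> 'l^2^2"
  where "mat_exp A = (\<Sum>n | mat_power A n \<noteq> 0. mat_scale (1 / of_nat (fact n)) (mat_power A n))"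

section \<open>Representations\<close>

definition character_on ::
    "('a::field \<Rightarrow> real) \<Rightarrow> 'a set \<Rightarrow> ('l::field \<Rightarrow> real) \<Rightarrow> ('a \<Rightarrow> 'a) set \<Rightarrow>
     (('a \<Rightarrow> 'a) \<Rightarrow> 'l) \<Rightarrow> bool"
  where "character_on v F w H chi \<longleftrightarrow>
    chi \<in> hom ((weil_group v F)\<lparr>carrier := H\<rparr>) (mult_of fld) \<and>
    continuous_map (subtopology (weil_topology v F) H) (val_topology w) chi"

definition weil_rep ::
    "('a::field \<Rightarrow> real) \<Rightarrow> 'a set \<Rightarrow> ('l::field \<Rightarrow> real) \<Rightarrow> (('a \<Rightarrow> 'a) \<Rightarrow> 'l^2^2) \<Rightarrow> bool"
  where "weil_rep v F w \<rho> \<longleftrightarrow>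
    \<rho> \<in> hom (weil_group v F) GL2 \<and>
    (\<forall>i j. continuous_map (weil_topology v F) (val_topology w) (\<lambda>g. \<rho> g $ i $ j))"

text \<open>\<open>(r, N)\<close> is the Weil--Deligne representation \<open>(\<rho>\<^sub>\<Phi>, N\<^sub>\<rho>)\<close> associated with \<open>\<rho>\<close>.\<close>
definition weil_deligne ::
    "('a::field \<Rightarrow> real) \<Rightarrow> 'a set \<Rightarrow> ('a \<Rightarrow> 'a) \<Rightarrow> (('a \<Rightarrow> 'a) \<Rightarrow> 'l::field) \<Rightarrow>
     (('a \<Rightarrow> 'a) \<Rightarrow> 'l^2^2) \<Rightarrow> (('a \<Rightarrow> 'a) \<Rightarrow> 'l^2^2) \<Rightarrow> 'l^2^2 \<Rightarrow> bool"
  where "weil_deligne v F \<Phi> t \<rho> r N \<longleftrightarrow>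
    mat_nilpotent N \<and>
    (\<exists>J. subgroup J (weil_group v F) \<and> J \<subseteq> inertia_group v F \<and> openin (weil_topology v F) J \<and>
       (\<forall>\<tau>\<in>J. \<rho> \<tau> = mat_exp (mat_scale (t \<tau>) N))) \<and>
    (\<forall>k. \<forall>\<tau> \<in> inertia_group v F.
       r (weil_elt v F \<Phi> k \<tau>) = \<rho> (weil_elt v F \<Phi> k \<tau>) ** mat_exp (mat_scale (- t \<tau>) N))"

definition wd_isomorphic ::
    "('a::field \<Rightarrow> real) \<Rightarrow> 'a set \<Rightarrow> (('a \<Rightarrow> 'a) \<Rightarrow> 'l::field^2^2) \<Rightarrow> 'l^2^2 \<Rightarrow>
     (('a \<Rightarrow> 'a) \<Rightarrow> 'l^2^2) \<Rightarrow> 'l^2^2 \<Rightarrow> bool"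
  where "wd_isomorphic v F r N r' N' \<longleftrightarrow>
    (\<exists>P \<in> GL2_over UNIV. (\<forall>g \<in> carrier (weil_group v F). r g ** P = P ** r' g) \<and> N ** P = P ** N')"

definition conj_character ::
    "('a::field \<Rightarrow> real) \<Rightarrow> 'a set \<Rightarrow> ('a \<Rightarrow> 'a) \<Rightarrow> (('a \<Rightarrow> 'a) \<Rightarrow> 'l) \<Rightarrow> ('a \<Rightarrow> 'a) \<Rightarrow> 'l"
  where "conj_character v F \<sigma> \<xi> h =
    \<xi> (\<sigma> \<otimes>\<^bsub>weil_group v F\<^esub> h \<otimes>\<^bsub>weil_group v F\<^esub> inv\<^bsub>weil_group v F\<^esub> \<sigma>)"

definition induced ::
    "('a::field \<Rightarrow> real) \<Rightarrow> 'a set \<Rightarrow> 'a set \<Rightarrow> ('a \<Rightarrow> 'a) \<Rightarrow> (('a \<Rightarrow> 'a) \<Rightarrow> 'l::field) \<Rightarrow>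
     ('a \<Rightarrow> 'a) \<Rightarrow> 'l^2^2"
  where "induced v F E \<sigma> \<xi> g =
    (if g \<in> weil_subgroup v F E then mat2 (\<xi> g) 0 0 (conj_character v F \<sigma> \<xi> g)
     else let h = g \<otimes>\<^bsub>weil_group v F\<^esub> inv\<^bsub>weil_group v F\<^esub> \<sigma> in
       mat2 0 (\<xi> h) (\<xi> (\<sigma> \<otimes>\<^bsub>weil_group v F\<^esub> h \<otimes>\<^bsub>weil_group v F\<^esub> \<sigma>)) 0)"

text \<open>\<open>\<rho>\<close> is (nonexceptional) supercuspidal, with Weil--Deligne representation \<open>(Ind \<xi>, 0)\<close>.\<close>
definition supercuspidal_of ::
    "('a::field \<Rightarrow> real) \<Rightarrow> 'a set \<Rightarrow> ('l::field \<Rightarrow> real) \<Rightarrow> ('a \<Rightarrow> 'a) \<Rightarrow> (('a \<Rightarrow> 'a) \<Rightarrow> 'l) \<Rightarrow>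
     'a set \<Rightarrow> ('a \<Rightarrow> 'a) \<Rightarrow> (('a \<Rightarrow> 'a) \<Rightarrow> 'l) \<Rightarrow> (('a \<Rightarrow> 'a) \<Rightarrow> 'l^2^2) \<Rightarrow> bool"
  where "supercuspidal_of v F w \<Phi> t E \<sigma> \<xi> \<rho> \<longleftrightarrow>
    weil_rep v F w \<rho> \<and>
    quadratic_extension F E \<and>
    \<sigma> \<in> carrier (weil_group v F) - weil_subgroup v F E \<and>
    character_on v F w (weil_subgroup v F E) \<xi> \<and>
    (\<exists>h \<in> weil_subgroup v F E. \<xi> h \<noteq> conj_character v F \<sigma> \<xi> h) \<and>
    (\<exists>r N. weil_deligne v F \<Phi> t \<rho> r N \<and> wd_isomorphic v F r N (induced v F E \<sigma> \<xi>) 0)"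

text \<open>\<open>\<rho>\<close> is special, with Weil--Deligne representation \<open>chi \<omega> \<oplus> chi\<close>.\<close>
definition special_of ::
    "('a::field \<Rightarrow> real) \<Rightarrow> 'a set \<Rightarrow> ('l::field \<Rightarrow> real) \<Rightarrow> ('a \<Rightarrow> 'a) \<Rightarrow> (('a \<Rightarrow> 'a) \<Rightarrow> 'l) \<Rightarrow>
     (('a \<Rightarrow> 'a) \<Rightarrow> 'l) \<Rightarrow> (('a \<Rightarrow> 'a) \<Rightarrow> 'l) \<Rightarrow> (('a \<Rightarrow> 'a) \<Rightarrow> 'l^2^2) \<Rightarrow> bool"
  where "special_of v F w \<Phi> t \<omega> chi \<rho> \<longleftrightarrow>
    weil_rep v F w \<rho> \<and>
    character_on v F w (carrier (weil_group v F)) chi \<and>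
    (\<exists>r N. weil_deligne v F \<Phi> t \<rho> r N \<and>
       wd_isomorphic v F r N (\<lambda>g. mat2 (chi g * \<omega> g) 0 0 (chi g)) (mat2 0 1 0 0))"

section \<open>Reduction\<close>

text \<open>
  \<open>red\<close> is the reduction map of the valuation ring of \<open>K\<close> onto its residue field, the latter being
  realised as a type \<open>'k\<close>.
\<close>
definition reduction_map :: "('l::field \<Rightarrow> real) \<Rightarrow> 'l set \<Rightarrow> ('l \<Rightarrow> 'k::field) \<Rightarrow> bool"
  where "reduction_map w K red \<longleftrightarrow>
    red \<in> ring_hom (fld\<lparr>carrier := val_ring w K\<rparr>) fld \<and>
    red ` val_ring w K = UNIV \<and>
    (\<forall>x \<in> val_ring w K. red x = 0 \<longleftrightarrow> x \<in> val_ideal w K)"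

definition reduce_rep :: "('l \<Rightarrow> 'k) \<Rightarrow> ('g \<Rightarrow> 'l^2^2) \<Rightarrow> 'g \<Rightarrow> 'k^2^2"
  where "reduce_rep red \<rho> g = (\<chi> i j. red (\<rho> g $ i $ j))"

definition reps_isomorphic :: "'g set \<Rightarrow> ('g \<Rightarrow> 'k::field^2^2) \<Rightarrow> ('g \<Rightarrow> 'k^2^2) \<Rightarrow> bool"
  where "reps_isomorphic G r r' \<longleftrightarrow> (\<exists>P \<in> GL2_over UNIV. \<forall>g\<in>G. r g ** P = P ** r' g)"

definition invariant_subspace :: "'g set \<Rightarrow> ('g \<Rightarrow> 'k::field^2^2) \<Rightarrow> ('k^2) set \<Rightarrow> bool"
  where "invariant_subspace G r U \<longleftrightarrow> vec.subspace U \<and> (\<forall>g\<in>G. \<forall>u\<in>U. r g *v u \<in> U)"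

definition indecomposable :: "'g set \<Rightarrow> ('g \<Rightarrow> 'k::field^2^2) \<Rightarrow> bool"
  where "indecomposable G r \<longleftrightarrow>
    \<not> (\<exists>U V. invariant_subspace G r U \<and> invariant_subspace G r V \<and> U \<noteq> {0} \<and> V \<noteq> {0} \<and>
         U \<inter> V = {0} \<and> (\<forall>x. \<exists>u\<in>U. \<exists>y\<in>V. x = u + y))"

end

theory Submission
  imports Defs
begin

text \<open>
  Since \<open>p\<close> is odd and \<open>E / F\<close> is unramified, \<open>W\<^sub>E\<close> contains the inertia group, has index two in \<open>W\<^sub>F\<close>
  and consists of the \<open>\<Phi>\<^sup>k \<tau>\<close> with \<open>k\<close> even. An inertia element with \<open>t \<tau> = 1\<close> acts under the
  reduction of \<open>\<rho>2\<close> as a scalar times a nontrivial unipotent matrix, so that reduction is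
  indecomposable, and every intertwiner with the reduction of \<open>\<rho>1\<close> is upper triangular. Comparing
  diagonals outside \<open>W\<^sub>E\<close>, where \<open>\<rho>1\<close> has trace zero, gives \<open>\<omega> = - 1\<close>, that is
  \<open>q = - 1\<close>, in the residue field, as well as \<open>chi \<sigma> = - a1 / b1\<close>; comparing on \<open>W\<^sub>E\<close> gives
  \<open>chi = \<xi>\<close> and the condition on \<open>x\<close>. Conversely that condition forces \<open>\<rho>1 \<sigma>\<close> to be
  upper triangular modulo \<open>\<lambda>\<close>, and an intertwiner with diagonal \<open>(x, 1)\<close> is found by
  solving one linear equation at \<open>\<sigma>\<close>, which is possible as \<open>l\<close> is odd.
\<close>

section \<open>Ultrametric absolute values and subfields\<close>

text \<open>Only the laws shared by both sides are collected, so that the same lemmas serve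
  \<open>v\<close> on the p-adic side and \<open>w\<close> on the l-adic side.\<close>

locale ultrametric_abs =
  fixes v :: "'a::field \<Rightarrow> real"
  assumes nonneg: "v x \<ge> 0"
    and eq_0: "v x = 0 \<longleftrightarrow> x = 0"
    and mult: "v (x * y) = v x * v y"
    and ultra: "v (x + y) \<le> max (v x) (v y)"
begin

lemma zero [simp]: "v 0 = 0"
  by (simp add: eq_0)

lemma one [simp]: "v 1 = 1"
  using mult[of 1 1] eq_0[of 1] by simp

lemma minus [simp]: "v (- x) = v x"
proof -
  have "v (- 1) * v (- 1) = 1"
    using mult[of "- 1" "- 1"] by simp
  then have "v (- 1) = 1"
    using nonneg[of "- 1"] by (metis abs_of_nonneg power2_eq_square real_sqrt_abs real_sqrt_one)
  then show ?thesis
    using mult[of "- 1" x] by simp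
qed

lemma minus_commute: "v (x - y) = v (y - x)"
  using minus[of "x - y"] by simp

lemma pow: "v (x ^ n) = v x ^ n"
  by (induction n) (simp_all add: mult)

lemma inv: "v (inverse x) = inverse (v x)"
proof (cases "x = 0")
  case False
  then have "v x * v (inverse x) = 1"
    using mult[of x "inverse x"] by simp
  then show ?thesis
    by (simp add: inverse_unique)
qed simp

lemma div: "v (x / y) = v x / v y"
  by (simp add: divide_inverse mult inv)

lemma add_le: "v x \<le> c \<Longrightarrow> v y \<le> c \<Longrightarrow> v (x + y) \<le> c"
  using ultra[of x y] by simp

lemma add_less: "v x < c \<Longrightarrow> v y < c \<Longrightarrow> v (x + y) < c"
  using ultra[of x y] by simp

lemma diff_le: "v x \<le> c \<Longrightarrow> v y \<le> c \<Longrightarrow> v (x - y) \<le> c"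
  using add_le[of x c "- y"] by simp

lemma mult_le_1: "v x \<le> 1 \<Longrightarrow> v y \<le> 1 \<Longrightarrow> v (x * y) \<le> 1"
  by (simp add: mult mult_le_one nonneg)

lemma pow_le_1: "v x \<le> 1 \<Longrightarrow> v (x ^ n) \<le> 1"
  by (simp add: pow power_le_one nonneg)

lemma cong_trans: "v (x - y) < 1 \<Longrightarrow> v (y - z) < 1 \<Longrightarrow> v (x - z) < 1"
  using add_less[of "x - y" 1 "y - z"] by simp

lemma cong_sym: "v (x - y) < 1 \<Longrightarrow> v (y - x) < 1"
  using minus_commute[of x y] by simp

lemma cong_le_1: "v (x - y) < 1 \<Longrightarrow> v y \<le> 1 \<Longrightarrow> v x \<le> 1"
  using add_le[of "x - y" 1 y] by simp

lemma cong_less_1: "v (x - y) < 1 \<Longrightarrow> v y < 1 \<Longrightarrow> v x < 1"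
  using add_less[of "x - y" 1 y] by simp

lemma cong_mult:
  assumes "v (x - x') < 1" "v (y - y') < 1" "v x' \<le> 1" "v y \<le> 1"
  shows "v (x * y - x' * y') < 1"
proof -
  have "x * y - x' * y' = (x - x') * y + x' * (y - y')"
    by (simp add: algebra_simps)
  moreover have "v ((x - x') * y) < 1"
    using assms nonneg[of y] nonneg[of "x - x'"] by (metis mult mult_left_le order_le_less_trans)
  moreover have "v (x' * (y - y')) < 1"
    using assms nonneg[of x'] nonneg[of "y - y'"] by (metis mult mult_left_le_one_le order_le_less_trans)
  ultimately show ?thesis
    using add_less by metis
qed

lemma cong_pow:
  assumes "v (x - y) < 1" "v x \<le> 1" "v y \<le> 1"
  shows "v (x ^ n - y ^ n) < 1"
  by (induction n) (use assms in \<open>auto intro!: cong_mult pow_le_1\<close>)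

lemma pow_eq_less_1: "v (x ^ n) < 1 \<Longrightarrow> v x < 1"
  by (metis nonneg not_less one_le_power pow)

lemma pow_le_1_D: "v (x ^ n) \<le> 1 \<Longrightarrow> n > 0 \<Longrightarrow> v x \<le> 1"
  by (metis not_less one_less_power pow)

lemma cong_val_UNIV: "cong_val v UNIV x y \<longleftrightarrow> v (x - y) < 1"
  by (simp add: cong_val_def val_ideal_def)

end

section \<open>Absolute values of natural numbers in a p-adic closure\<close>

sublocale padic_closure \<subseteq> ultrametric_abs v
  by unfold_locales (auto simp: v_nonneg v_eq_0 v_mult v_add)

context padic_closure
begin

text \<open>By the normalisation \<open>v_padic\<close> the residue characteristic is
  \<open>p\<close>; applied to \<open>w\<close> and \<open>l\<close>, this turns a congruence modulo
  \<open>l\<close> into an equation in the residue field.\<close>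

lemma v_of_nat_less_1_iff: "n > 0 \<Longrightarrow> v (of_nat n) < 1 \<longleftrightarrow> p dvd n"
proof -
  assume n: "n > 0"
  have "1 < real p"
    using prime prime_gt_1_nat by auto
  then have "1 / real p ^ multiplicity p n < 1 \<longleftrightarrow> multiplicity p n > 0"
    by (cases "multiplicity p n = 0") (auto simp: divide_less_eq intro: one_less_power)
  moreover have "multiplicity p n > 0 \<longleftrightarrow> p dvd n"
    using n prime by (simp add: prime_multiplicity_gt_zero_iff)
  ultimately show ?thesis
    using v_padic[OF n] by simp
qed

lemma v_of_nat_le_1: "v (of_nat n) \<le> 1"
proof (induction n)
  case (Suc n)
  then show ?case using add_le[of 1 1 "of_nat n"] by simp
qed simp

lemma v_2: "odd p \<Longrightarrow> v 2 = 1"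
proof -
  assume "odd p"
  then have "\<not> p dvd 2"
    using prime by (metis dvd_refl prime_nat_iff prime_ge_2_nat nat_dvd_not_less dvd_imp_le
        le_antisym zero_less_numeral)
  then show ?thesis
    using v_of_nat_less_1_iff[of 2] v_of_nat_le_1[of 2] by simp
qed

end

section \<open>Subfields of a field type and quadratic extensions\<close>

lemma carrier_fld [simp]: "carrier fld = UNIV"
  and mult_fld [simp]: "monoid.mult fld = (*)"
  and one_fld [simp]: "one fld = 1"
  and zero_fld [simp]: "ring.zero fld = 0"
  and add_fld [simp]: "ring.add fld = (+)"
  by (simp_all add: ring_of_type_algebra_def fun_eq_iff)

locale subfield_type =
  fixes K :: "'a::field set"
  assumes subfield: "subfield K fld"
begin

lemma mem_0: "0 \<in> K"
  and mem_1: "1 \<in> K"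
  and mem_add: "x \<in> K \<Longrightarrow> y \<in> K \<Longrightarrow> x + y \<in> K"
  and mem_mult: "x \<in> K \<Longrightarrow> y \<in> K \<Longrightarrow> x * y \<in> K"
  using subringE[OF subfieldE(1)[OF subfield]] by auto

lemma mem_minus: "x \<in> K \<Longrightarrow> - x \<in> K"
proof -
  interpret R: ring "fld :: 'a ring" by (rule ring_from_type_algebra)
  assume "x \<in> K"
  then have "\<ominus>\<^bsub>fld\<^esub> x \<in> K"
    using subringE(5)[OF subfieldE(1)[OF subfield]] by auto
  moreover have "\<ominus>\<^bsub>fld\<^esub> x = - x"
    using R.minus_equality[of "- x" x] by simp
  ultimately show ?thesis by simp
qed

lemma mem_diff: "x \<in> K \<Longrightarrow> y \<in> K \<Longrightarrow> x - y \<in> K"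
  using mem_add[of x "- y"] mem_minus by simp

lemma mem_inverse: "x \<in> K \<Longrightarrow> inverse x \<in> K"
proof (cases "x = 0")
  case False
  interpret R: ring "fld :: 'a ring" by (rule ring_from_type_algebra)
  assume "x \<in> K"
  then have "inv\<^bsub>fld\<^esub> x \<in> K" "x * inv\<^bsub>fld\<^esub> x = 1"
    using R.subfield_m_inv[OF subfield, of x] False by auto
  then show ?thesis by (simp add: inverse_unique)
qed simp

lemma mem_divide: "x \<in> K \<Longrightarrow> y \<in> K \<Longrightarrow> x / y \<in> K"
  by (simp add: divide_inverse mem_mult mem_inverse)

lemma mem_of_nat: "of_nat n \<in> K"
  by (induction n) (auto simp: mem_0 mem_1 mem_add)

lemma mem_numeral: "numeral n \<in> K"
  using mem_of_nat[of "numeral n"] by simp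

end

lemma finite_extension_subfield:
  assumes "finite_extension F E"
  shows "subfield_type F" "subfield_type E" "F \<subseteq> E"
  using assms by (auto simp: finite_extension_def subfield_type_def)

text \<open>The inductive definition of dimension yields some spanning pair \<open>u\<close>,
  \<open>u'\<close>; Cramer's rule replaces it by \<open>1\<close> and \<open>s\<close>.\<close>

lemma quadratic_extension_gen:
  assumes E: "quadratic_extension F E" and s: "s \<in> E" "s \<notin> F" and y: "y \<in> E"
  obtains \<alpha> \<beta> where "\<alpha> \<in> F" "\<beta> \<in> F" "y = \<alpha> + \<beta> * s"
proof -
  interpret R: ring "fld :: 'a ring" by (rule ring_from_type_algebra)
  have fe: "finite_extension F E" and d: "R.dimension 2 F E"
    using E by (auto simp: quadratic_extension_def)
  interpret F: subfield_type F using finite_extension_subfield[OF fe] by simp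
  interpret E: subfield_type E using finite_extension_subfield[OF fe] by simp
  obtain u E' where u: "E = R.line_extension F u E'" and E': "R.dimension 1 F E'"
    using d by (cases rule: R.dimension.cases) (auto simp: numeral_2_eq_2)
  obtain u' E'' where u': "E' = R.line_extension F u' E''" and "R.dimension 0 F E''"
    using E' by (cases rule: R.dimension.cases) auto
  then have "E'' = {0}"
    using R.dimension_zero[of F E''] F.subfield by auto
  then have E'_eq: "z \<in> E' \<longleftrightarrow> (\<exists>b\<in>F. z = b * u')" for z
    unfolding u' by (simp add: R.line_extension_mem_iff)
  have E_eq: "y \<in> E \<longleftrightarrow> (\<exists>a\<in>F. \<exists>b\<in>F. y = a * u + b * u')" for y
    unfolding u by (auto simp: R.line_extension_mem_iff E'_eq Bex_def)
  obtain a b where ab: "a \<in> F" "b \<in> F" "1 = a * u + b * u'"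
    using E_eq[of 1] E.mem_1 by blast
  obtain c d where cd: "c \<in> F" "d \<in> F" "s = c * u + d * u'"
    using E_eq[of s] s by blast
  obtain e f where ef: "e \<in> F" "f \<in> F" "y = e * u + f * u'"
    using E_eq[of y] y by blast
  \<comment> \<open>Determinant of \<open>1\<close> and \<open>s\<close> in the coordinates given by
    \<open>u\<close> and \<open>u'\<close>; if it vanished, \<open>s\<close> would be a quotient of
    elements of \<open>F\<close>.\<close>
  define D where "D = a * d - b * c"
  have D: "D \<noteq> 0"
  proof
    assume D: "D = 0"
    have "a * s = c * 1" if "D = 0"
      unfolding cd(3) ab(3) using that by (simp add: D_def algebra_simps)
    moreover have "b * s = d * 1" if "D = 0"
      unfolding cd(3) ab(3) using that by (simp add: D_def algebra_simps)
    ultimately have "a * s = c" "b * s = d"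
      using D by auto
    moreover have "a \<noteq> 0 \<or> b \<noteq> 0"
      using ab by auto
    ultimately have "s = c / a \<or> s = d / b"
      by (auto simp: field_simps)
    then show False
      using s ab cd F.mem_divide by auto
  qed
  have "D * y = (e * d - f * c) * (a * u + b * u') + (f * a - e * b) * (c * u + d * u')"
    unfolding ef(3) D_def by (simp add: algebra_simps)
  then have "D * y = (e * d - f * c) + (f * a - e * b) * s"
    using ab(3) cd(3) by simp
  then have "y = (e * d - f * c) / D + (f * a - e * b) / D * s"
    using D by (metis add_divide_distrib nonzero_mult_div_cancel_left times_divide_eq_left)
  moreover have "(e * d - f * c) / D \<in> F" "(f * a - e * b) / D \<in> F"
    using ab cd ef by (auto simp: D_def intro!: F.mem_divide F.mem_diff F.mem_mult)
  ultimately show thesis using that by blast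
qed

section \<open>Weil groups\<close>

lemma gal_iff:
  "g \<in> gal F \<longleftrightarrow> bij g \<and> (\<forall>x y. g (x + y) = g x + g y) \<and> (\<forall>x y. g (x * y) = g x * g y) \<and>
     g 1 = 1 \<and> (\<forall>x\<in>F. g x = x)"
  by (auto simp: gal_def ring_iso_def ring_hom_def)

lemma gal_comp: "g \<in> gal F \<Longrightarrow> h \<in> gal F \<Longrightarrow> g \<circ> h \<in> gal F"
  by (auto simp: gal_iff intro: bij_comp)

lemma gal_id: "id \<in> gal F"
  by (auto simp: gal_iff)

lemma gal_inv: 
  assumes "g \<in> gal F"
  shows "inv_into UNIV g \<in> gal F"
proof -
  have bij: "bij g" using assms by (simp add: gal_iff)
  have ap: "inv_into UNIV g (g x) = x" "g (inv_into UNIV g x) = x" for x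
    using bij by (simp_all add: bij_is_inj bij_is_surj surj_f_inv_f)
  have eqI: "inv_into UNIV g x = y" if "x = g y" for x y
    using that ap by simp
  show ?thesis
    unfolding gal_iff
    using assms bij ap bij_imp_bij_inv[OF bij]
    by (auto simp: gal_iff intro!: eqI)
qed

lemma gal_pow: "g \<in> gal F \<Longrightarrow> g (x ^ n) = g x ^ n"
  by (induction n) (auto simp: gal_iff)

lemma gal_add: "g \<in> gal F \<Longrightarrow> g (x + y) = g x + g y"
  and gal_mult: "g \<in> gal F \<Longrightarrow> g (x * y) = g x * g y"
  and gal_1: "g \<in> gal F \<Longrightarrow> g 1 = 1"
  and gal_fix: "g \<in> gal F \<Longrightarrow> x \<in> F \<Longrightarrow> g x = x"
  by (simp_all add: gal_iff)

lemma gal_0: "g \<in> gal F \<Longrightarrow> g 0 = 0"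
  using gal_add[of g F 0 0] by (simp only: add_0_right add_cancel_right_right)

lemma gal_minus: "g \<in> gal F \<Longrightarrow> g (- x) = - g x"
  using gal_add[of g F x "- x"] gal_0[of g F] by (simp add: eq_neg_iff_add_eq_0 add.commute)

lemma gal_diff: "g \<in> gal F \<Longrightarrow> g (x - y) = g x - g y"
  using gal_add[of g F x "- y"] gal_minus[of g F y] by simp

lemma mult_weil_group [simp]: "monoid.mult (weil_group v F) = (\<circ>)"
  and one_weil_group [simp]: "one (weil_group v F) = id"
  by (simp_all add: weil_group_def)

text \<open>On the residue field of the algebraic closure, \<open>Frob\<^sup>m \<circ> g = Frob\<^sup>n\<close> with \<open>Frob x = x\<^sup>q\<close>.\<close>
definition frob_degree :: "('a::field \<Rightarrow> real) \<Rightarrow> nat \<Rightarrow> ('a \<Rightarrow> 'a) \<Rightarrow> nat \<Rightarrow> nat \<Rightarrow> bool"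
  where "frob_degree v q g m n \<longleftrightarrow> (\<forall>x. v x \<le> 1 \<longrightarrow> v (g x ^ (q ^ m) - x ^ (q ^ n)) < 1)"

context ultrametric_abs
begin

text \<open>Integrality of \<open>g x\<close> comes from the congruence itself:
  \<open>g x ^ (q ^ m)\<close> is congruent to an integral element, and \<open>q > 0\<close> allows
  a root to be taken.\<close>

lemma frob_degree_le_1:
  "frob_degree v q g m n \<Longrightarrow> q > 0 \<Longrightarrow> v x \<le> 1 \<Longrightarrow> v (g x) \<le> 1"
  using cong_le_1[OF _ pow_le_1, of "g x ^ (q ^ m)" x "q ^ n"] pow_le_1_D[of "g x" "q ^ m"]
  by (simp add: frob_degree_def)

lemma frob_degree_less_1:
  assumes "frob_degree v q g m n" "q > 0" "v x < 1"
  shows "v (g x) < 1"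
proof -
  have "v (x ^ (q ^ n)) < 1"
    using assms nonneg[of x] by (simp add: pow power_less_one_iff)
  moreover have "v (g x ^ (q ^ m) - x ^ (q ^ n)) < 1"
    using assms by (simp add: frob_degree_def)
  ultimately show ?thesis
    using cong_less_1 pow_eq_less_1 by blast
qed

text \<open>The congruence for \<open>g\<close> at \<open>h x\<close>, raised to the power
  \<open>q ^ m'\<close>, is chained with the one for \<open>h\<close>, raised to the power
  \<open>q ^ n\<close>; the middle terms agree because iterated powers commute.\<close>

lemma frob_degree_comp:
  assumes q: "q > 0" and g: "g \<in> gal F" "frob_degree v q g m n"
    and h: "frob_degree v q h m' n'"
  shows "frob_degree v q (g \<circ> h) (m + m') (n + n')"
  unfolding frob_degree_def
proof (intro allI impI)
  fix x assume x: "v x \<le> 1"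
  have hx: "v (h x) \<le> 1"
    using frob_degree_le_1[OF h q x] .
  have ghx: "v (g (h x)) \<le> 1"
    using frob_degree_le_1[OF g(2) q hx] .
  have "v (g (h x) ^ (q ^ m) - h x ^ (q ^ n)) < 1"
    using g hx by (simp add: frob_degree_def)
  then have "v ((g (h x) ^ (q ^ m)) ^ (q ^ m') - (h x ^ (q ^ n)) ^ (q ^ m')) < 1"
    by (intro cong_pow pow_le_1 hx ghx)
  moreover have "v ((h x ^ (q ^ m')) ^ (q ^ n) - (x ^ (q ^ n')) ^ (q ^ n)) < 1"
    using h x by (intro cong_pow pow_le_1 hx) (auto simp: frob_degree_def)
  moreover have "(h x ^ (q ^ m')) ^ (q ^ n) = (h x ^ (q ^ n)) ^ (q ^ m')"
    by (simp add: power_mult [symmetric] mult.commute)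
  ultimately have "v ((g (h x) ^ (q ^ m)) ^ (q ^ m') - (x ^ (q ^ n')) ^ (q ^ n)) < 1"
    using cong_trans by metis
  then show "v ((g \<circ> h) x ^ q ^ (m + m') - x ^ q ^ (n + n')) < 1"
    by (simp add: power_mult [symmetric] power_add mult.commute)
qed

end

section \<open>The Weil group as a group, and its elements as Frobenius power times inertia\<close>

locale weil_frobenius = padic_closure p Q v + subfield_type F
  for p :: nat and Q :: "'a::alg_closed_field set" and v :: "'a \<Rightarrow> real" and F +
  fixes \<Phi> :: "'a \<Rightarrow> 'a"
  assumes frob: "frobenius_element v F \<Phi>"
begin

abbreviation "q \<equiv> residue_card v F"
abbreviation "W \<equiv> weil_group v F"
abbreviation "I \<equiv> inertia_group v F"

lemma carrier_weil_iff: "g \<in> carrier W \<longleftrightarrow> g \<in> gal F \<and> (\<exists>m n. frob_degree v q g m n)"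
  by (auto simp: weil_group_def frob_degree_def val_ring_def cong_val_UNIV)

lemma carrier_gal: "g \<in> carrier W \<Longrightarrow> g \<in> gal F"
  by (simp add: carrier_weil_iff)

lemma inertia_iff: "g \<in> I \<longleftrightarrow> g \<in> gal F \<and> frob_degree v q g 0 0"
  by (auto simp: inertia_group_def frob_degree_def val_ring_def cong_val_UNIV)

lemma inertia_subset: "I \<subseteq> carrier W"
  by (meson inertia_iff carrier_weil_iff subsetI)

lemma Phi_carrier: "\<Phi> \<in> carrier W"
  using frob by (simp add: frobenius_element_def)

lemma Phi_degree: "frob_degree v q \<Phi> 1 0"
  using frob by (simp add: frobenius_element_def frob_degree_def val_ring_def cong_val_UNIV)

text \<open>\<open>card\<close> gives \<open>0\<close> on infinite sets, so positivity needs an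
  argument: for \<open>q = 0\<close> the congruence of \<Phi> at \<open>0\<close> would read
  \<open>v (1 - 0) < 1\<close>.\<close>

lemma q_pos: "q > 0"
proof (rule ccontr)
  assume "\<not> q > 0"
  moreover have "v (\<Phi> 0 ^ (q ^ 1) - 0 ^ (q ^ 0)) < 1"
    using Phi_degree zero zero_le_one unfolding frob_degree_def by metis
  ultimately show False by simp
qed

text \<open>This is the congruence of \<open>g\<close> at the preimage of \<open>x\<close>, read
  backwards, once that preimage is known to be integral.\<close>

lemma frob_degree_inv:
  assumes g: "g \<in> carrier W" "frob_degree v q g m n"
  shows "frob_degree v q (inv_into UNIV g) n m"
proof -
  have gg: "g \<in> gal F" by (rule carrier_gal[OF g(1)])
  then have bij: "bij g" by (simp add: gal_iff)
  let ?h = "inv_into UNIV g"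
  have gh: "g (?h x) = x" for x
    using bij by (simp add: bij_is_surj surj_f_inv_f)
  \<comment> \<open>Otherwise the reciprocal of the preimage lies in the maximal ideal, hence so
    does its image under \<open>g\<close>; but that image times the integral \<open>x\<close> is
    \<open>1\<close>.\<close>
  have h_le: "v (?h x) \<le> 1" if x: "v x \<le> 1" for x
  proof (rule ccontr)
    assume *: "\<not> v (?h x) \<le> 1"
    then have "v (inverse (?h x)) < 1"
      by (simp add: inv inverse_less_1_iff)
    then have "v (g (inverse (?h x))) < 1"
      using frob_degree_less_1[OF g(2) q_pos] by blast
    moreover have "?h x \<noteq> 0"
      using * by auto
    then have "g (inverse (?h x)) * x = 1"
      using gh[of x] gal_mult[OF gg, of "inverse (?h x)" "?h x"] gal_1[OF gg] by simp
    then have "v (g (inverse (?h x))) * v x = 1"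
      by (metis mult one)
    ultimately show False
      using x nonneg[of "g (inverse (?h x))"] by (metis mult_left_le not_less)
  qed
  show ?thesis
    unfolding frob_degree_def
      proof (intro allI impI)
    fix x assume x: "v x \<le> 1"
    have "v (g (?h x) ^ (q ^ m) - ?h x ^ (q ^ n)) < 1"
      using g(2) h_le[OF x] by (simp add: frob_degree_def)
    then show "v (?h x ^ (q ^ n) - x ^ (q ^ m)) < 1"
      using cong_sym gh by simp
  qed
qed

lemma weil_inv_into:
  assumes "g \<in> carrier W"
  shows "inv_into UNIV g \<in> carrier W"
proof -
  obtain m n where "frob_degree v q g m n"
    using assms by (auto simp: carrier_weil_iff)
  then show ?thesis
    using frob_degree_inv[OF assms] gal_inv[OF carrier_gal[OF assms]] by (auto simp: carrier_weil_iff)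
qed

sublocale weil: group W
proof (rule groupI)
  show "g \<otimes>\<^bsub>W\<^esub> h \<in> carrier W" if "g \<in> carrier W" "h \<in> carrier W" for g h
    using that frob_degree_comp[OF q_pos] gal_comp unfolding carrier_weil_iff mult_weil_group
    by meson
  show "\<one>\<^bsub>W\<^esub> \<in> carrier W"
    unfolding carrier_weil_iff by (auto simp: gal_id frob_degree_def intro!: exI[of _ 0])
  show "\<exists>h\<in>carrier W. h \<otimes>\<^bsub>W\<^esub> g = \<one>\<^bsub>W\<^esub>" if g: "g \<in> carrier W" for g
  proof (intro bexI[of _ "inv_into UNIV g"])
    have "bij g"
      using g unfolding carrier_weil_iff by (simp add: gal_iff)
    then show "inv_into UNIV g \<otimes>\<^bsub>W\<^esub> g = \<one>\<^bsub>W\<^esub>"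
      by (simp add: bij_is_inj)
    show "inv_into UNIV g \<in> carrier W"
      by (rule weil_inv_into[OF g])
  qed
qed (auto simp: comp_assoc)

lemma inv_weil: 
  assumes "g \<in> carrier W"
  shows "inv\<^bsub>W\<^esub> g = inv_into UNIV g"
proof (rule weil.inv_equality)
  have "g \<in> gal F"
    by (rule carrier_gal[OF assms])
  then show "inv_into UNIV g \<otimes>\<^bsub>W\<^esub> g = \<one>\<^bsub>W\<^esub>"
    by (simp add: gal_iff bij_is_inj)
  show "inv_into UNIV g \<in> carrier W"
    by (rule weil_inv_into[OF assms])
qed (fact assms)

lemma Phi_pow_degree: "frob_degree v q (\<Phi> [^]\<^bsub>W\<^esub> (n :: nat)) n 0"
proof (induction n)
  case 0
  show ?case by (simp add: frob_degree_def)
next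
  case (Suc n)
  have "\<Phi> [^]\<^bsub>W\<^esub> n \<in> gal F"
    by (intro carrier_gal weil.nat_pow_closed Phi_carrier)
  then show ?case
    using frob_degree_comp[OF q_pos _ Suc Phi_degree] by (simp del: comp_apply add: comp_def)
qed

text \<open>On the residue field \<open>x \<mapsto> x\<^sup>q\<close> inverts \<open>\<Phi>\<close>, hence is injective there.\<close>
lemma q_pow_inj:
  assumes "v x \<le> 1" "v y \<le> 1" "v (x ^ (q ^ n) - y ^ (q ^ n)) < 1"
  shows "v (x - y) < 1"
proof -
  let ?f = "\<Phi> [^]\<^bsub>W\<^esub> n"
  have f: "?f \<in> gal F"
    by (intro carrier_gal weil.nat_pow_closed Phi_carrier)
  have "v (?f (x ^ (q ^ n) - y ^ (q ^ n))) < 1"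
    using frob_degree_less_1[OF Phi_pow_degree q_pos assms(3)] .
  then have "v (?f x ^ (q ^ n) - ?f y ^ (q ^ n)) < 1"
    by (simp add: gal_diff[OF f] gal_pow[OF f])
  moreover have "v (?f z ^ (q ^ n) - z) < 1" if "v z \<le> 1" for z
    using Phi_pow_degree[of n] that by (auto simp: frob_degree_def)
  then have "v (x - ?f x ^ (q ^ n)) < 1" "v (?f y ^ (q ^ n) - y) < 1"
    using assms cong_sym by auto
  ultimately show ?thesis
    using cong_trans by blast
qed

text \<open>If \<open>g\<close> has degree \<open>m\<close>, \<open>n\<close>, then on the residue
  field it acts like the power \<open>m - n\<close> of \<Phi>. Removing that power leaves an element
  of degree \<open>n + m\<close>, \<open>n + m\<close>, which is inertial by
  \<open>q_pow_inj\<close>.\<close>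

lemma weil_elt_exhaust:
  assumes "g \<in> carrier W"
  obtains k \<tau> where "\<tau> \<in> I" "g = weil_elt v F \<Phi> k \<tau>"
proof -
  obtain m n where mn: "frob_degree v q g m n" and gg: "g \<in> gal F"
    using assms unfolding carrier_weil_iff by blast
  define A where "A = \<Phi> [^]\<^bsub>W\<^esub> n"
  define B where "B = \<Phi> [^]\<^bsub>W\<^esub> m"
  have AB: "A \<in> carrier W" "B \<in> carrier W"
    by (simp_all add: A_def B_def Phi_carrier)
  have iB: "frob_degree v q (inv\<^bsub>W\<^esub> B) 0 m"
    using frob_degree_inv[OF AB(2)] Phi_pow_degree[of m] inv_weil[OF AB(2)] by (simp add: B_def)
  have "A \<in> gal F" "inv\<^bsub>W\<^esub> B \<in> gal F"
    using AB by (auto intro: carrier_gal)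
  then have iBg: "frob_degree v q (inv\<^bsub>W\<^esub> B \<circ> g) (0 + m) (m + n)"
    using mn frob_degree_comp[OF q_pos _ iB] by blast
  have \<tau>: "frob_degree v q (A \<circ> (inv\<^bsub>W\<^esub> B \<circ> g)) (n + m) (n + m)"
    using frob_degree_comp[OF q_pos \<open>A \<in> gal F\<close> Phi_pow_degree[of n, folded A_def] iBg]
    by (simp add: add.commute del: comp_apply)
  define \<tau> where "\<tau> = A \<circ> (inv\<^bsub>W\<^esub> B \<circ> g)"
  have \<tau>W: "\<tau> \<in> carrier W"
    using AB assms weil.m_closed[of A] weil.m_closed[of "inv\<^bsub>W\<^esub> B"] by (simp add: \<tau>_def)
  have "v (\<tau> x - x) < 1" if x: "v x \<le> 1" for x
  proof (rule q_pow_inj[of _ _ "n + m"])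
    show "v (\<tau> x) \<le> 1"
      using frob_degree_le_1[OF \<tau>] q_pos x by (simp add: \<tau>_def)
    show "v (\<tau> x ^ q ^ (n + m) - x ^ q ^ (n + m)) < 1"
      using \<tau> x unfolding frob_degree_def \<tau>_def by blast
  qed (fact x)
  then have "\<tau> \<in> I"
    using carrier_gal[OF \<tau>W] by (simp add: inertia_iff frob_degree_def)
  moreover have "\<tau> = (A \<otimes>\<^bsub>W\<^esub> inv\<^bsub>W\<^esub> B) \<otimes>\<^bsub>W\<^esub> g"
    by (simp add: \<tau>_def comp_assoc)
  moreover have "A \<otimes>\<^bsub>W\<^esub> inv\<^bsub>W\<^esub> B = \<Phi> [^]\<^bsub>W\<^esub> (int n - int m)"
    by (simp only: weil.int_pow_diff[OF Phi_carrier] int_pow_int A_def B_def)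
  moreover have "g = (\<Phi> [^]\<^bsub>W\<^esub> (int m - int n)) \<otimes>\<^bsub>W\<^esub> (\<Phi> [^]\<^bsub>W\<^esub> (int n - int m) \<otimes>\<^bsub>W\<^esub> g)"
  proof -
    have "\<Phi> [^]\<^bsub>W\<^esub> (int m - int n) \<otimes>\<^bsub>W\<^esub> \<Phi> [^]\<^bsub>W\<^esub> (int n - int m) = \<one>\<^bsub>W\<^esub>"
      using weil.int_pow_mult[OF Phi_carrier, of "int m - int n" "int n - int m"] by simp
    then show ?thesis
      using weil.m_assoc[OF weil.int_pow_closed weil.int_pow_closed assms, OF Phi_carrier Phi_carrier,
          of "int m - int n" "int n - int m"] weil.l_one[OF assms] by simp
  qed
  ultimately have "g = weil_elt v F \<Phi> (int m - int n) \<tau>"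
    unfolding weil_elt_def by simp
  with \<open>\<tau> \<in> I\<close> show thesis using that by blast
qed

end

text \<open>Completing the square turns an element \<open>x\<close> moved by \<sigma> into
  \<open>s\<close> with \<open>s * s\<close> in \<open>F\<close>. So \<open>gal F\<close> acts on
  \<open>s\<close> by signs, and since \<open>1\<close> and \<open>s\<close> span \<open>E\<close>,
  the sign alone decides membership in \<open>gal E\<close>.\<close>

lemma quadratic_extension_sqrt:
  fixes F E :: "'a::field set"
  assumes E: "quadratic_extension F E" and two: "(2 :: 'a) \<noteq> 0"
    and \<sigma>: "\<sigma> \<in> gal F" "\<sigma> \<notin> gal E"
  obtains s where "s \<in> E" "s \<noteq> 0" "\<forall>g\<in>gal F. g s = s \<or> g s = - s"
    "\<forall>g\<in>gal F. g \<in> gal E \<longleftrightarrow> g s = s"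
proof -
  have fe: "finite_extension F E"
    using E by (auto simp: quadratic_extension_def)
  interpret F: subfield_type F using finite_extension_subfield[OF fe] by simp
  interpret E: subfield_type E using finite_extension_subfield[OF fe] by simp
  obtain x where x: "x \<in> E" "\<sigma> x \<noteq> x"
    using \<sigma> by (auto simp: gal_iff)
  then have xF: "x \<notin> F"
    using \<sigma> by (auto simp: gal_iff)
  obtain \<alpha> \<beta> where ab: "\<alpha> \<in> F" "\<beta> \<in> F" "x * x = \<alpha> + \<beta> * x"
    using quadratic_extension_gen[OF E x(1) xF E.mem_mult[OF x(1) x(1)]] by blast
  define s where "s = x - \<beta> / 2"
  have b2: "\<beta> / 2 \<in> F"
    using ab F.mem_divide F.mem_numeral by blast
  have sE: "s \<in> E"
    unfolding s_def using x b2 finite_extension_subfield(3)[OF fe] E.mem_diff by blast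
  have sF: "s \<notin> F"
    using xF F.mem_add[OF _ b2, of s] by (auto simp: s_def)
  have "s * s = x * x - \<beta> * x + \<beta> / 2 * (\<beta> / 2)"
  proof -
    define b where "b = \<beta> / 2"
    have "\<beta> = b + b"
      using two by (simp add: b_def flip: mult_2)
    then show ?thesis
      unfolding s_def b_def [symmetric] by (simp add: algebra_simps)
  qed
  then have "s * s = \<alpha> + \<beta> / 2 * (\<beta> / 2)"
    using ab by simp
  then have ss: "s * s \<in> F"
    using F.mem_add[OF ab(1) F.mem_mult[OF b2 b2]] by simp
  have pm: "g s = s \<or> g s = - s" if "g \<in> gal F" for g
    
  proof -
    have "g s * g s = s * s"
      using gal_mult[OF that, of s s] gal_fix[OF that ss] by simp
    then show ?thesis by (simp only: square_eq_iff)
  qed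
  have iff: "g \<in> gal E \<longleftrightarrow> g s = s" if g: "g \<in> gal F" for g
  proof
    assume s: "g s = s"
    have "g y = y" if y: "y \<in> E" for y
    proof -
      obtain c d where "c \<in> F" "d \<in> F" "y = c + d * s"
        using quadratic_extension_gen[OF E sE sF y] by blast
      then show ?thesis using g s by (simp add: gal_iff)
    qed
    then show "g \<in> gal E" using g by (simp add: gal_iff)
  qed (use sE in \<open>auto simp: gal_iff\<close>)
  have "s \<noteq> 0"
    using sF F.mem_0 by auto
  then show thesis
    using that[OF sE] pm iff by simp
qed

section \<open>The subgroup of the Weil group attached to a quadratic extension\<close>

context weil_frobenius
begin

context
  fixes E \<sigma>
  assumes odd_p: "odd p" and quadr: "quadratic_extension F E"
    and \<sigma>: "\<sigma> \<in> carrier W - weil_subgroup v F E"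
begin

lemma \<sigma>_gal: "\<sigma> \<in> gal F" "\<sigma> \<notin> gal E"
  using \<sigma> by (auto simp: carrier_weil_iff weil_subgroup_def)

lemma two_neq_0: "(2 :: 'a) \<noteq> 0"
  using v_2[OF odd_p] eq_0[of 2] by auto

text \<open>The sign by which an element acts on \<open>s\<close> is multiplicative, and the
  subgroup is its kernel. The signs are distinguishable because \<open>2\<close> is nonzero.\<close>

lemma weil_subgroup_parity:
  assumes g: "g \<in> carrier W" and h: "h \<in> carrier W"
  shows "g \<otimes>\<^bsub>W\<^esub> h \<in> weil_subgroup v F E \<longleftrightarrow>
    (g \<in> weil_subgroup v F E \<longleftrightarrow> h \<in> weil_subgroup v F E)"
proof -
  obtain s where "s \<in> E" and s: "s \<noteq> 0" "\<forall>g\<in>gal F. g s = s \<or> g s = - s"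
    "\<forall>g\<in>gal F. g \<in> gal E \<longleftrightarrow> g s = s"
    by (rule quadratic_extension_sqrt[OF quadr two_neq_0 \<sigma>_gal])
  have iff: "g \<in> weil_subgroup v F E \<longleftrightarrow> g s = s" if "g \<in> carrier W" for g
    using that bspec[OF s(3) carrier_gal[OF that]] unfolding weil_subgroup_def by simp
  have gal: "g \<in> gal F" "h \<in> gal F"
    using g h carrier_gal by auto
  have "- s \<noteq> s"
    using s(1) two_neq_0 by (simp add: minus_equation_iff neg_eq_iff_add_eq_0 flip: mult_2)
  then have "g (h s) = s \<longleftrightarrow> (g s = s \<longleftrightarrow> h s = s)"
    using bspec[OF s(2) gal(1)] bspec[OF s(2) gal(2)] gal_minus[OF gal(1), of s] by auto
  then show ?thesis
    using iff[OF g] iff[OF h] iff[OF weil.m_closed[OF g h]] by simp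
qed

text \<open>
  After scaling by \<open>F\<close>, the generator \<open>s\<close> is a unit; then \<open>s\<close> and \<open>- s\<close> differ in the residue
  field because \<open>p\<close> is odd, so inertia cannot exchange them.
\<close>
lemma inertia_subset_weil_subgroup:
  assumes unr: "unramified v F E"
  shows "I \<subseteq> weil_subgroup v F E"
proof
  fix \<tau> assume \<tau>: "\<tau> \<in> I"
  then have \<tau>F: "\<tau> \<in> gal F" by (simp add: inertia_iff)
  obtain s where s: "s \<in> E" "s \<noteq> 0" "\<forall>g\<in>gal F. g s = s \<or> g s = - s"
    "\<forall>g\<in>gal F. g \<in> gal E \<longleftrightarrow> g s = s"
    by (rule quadratic_extension_sqrt[OF quadr two_neq_0 \<sigma>_gal])
  obtain c where c: "c \<in> F" "v c = v s"
    using unr s(1) unfolding unramified_def by (metis image_eqI imageE)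
  then have c0: "c \<noteq> 0"
    using s(2) by (metis eq_0)
  have v1: "v (s / c) = 1"
    using c s(2) by (simp add: div eq_0)
  have "\<tau> c = c" "\<tau> (s / c) * \<tau> c = \<tau> s"
    using gal_fix[OF \<tau>F c(1)] gal_mult[OF \<tau>F, of "s / c" c] c0 by simp_all
  then have \<tau>sc: "\<tau> (s / c) = \<tau> s / c"
    using c0 by (simp add: field_simps)
  have "v (\<tau> (s / c) - s / c) < 1"
    using \<tau> v1 by (simp add: inertia_iff frob_degree_def)
  moreover have "v (- s / c - s / c) = 1"
  proof -
    have "- s / c - s / c = - (2 * (s / c))" by simp
    then show ?thesis using v1 v_2[OF odd_p] mult[of 2 "s / c"] by (simp only: minus)
  qed
  ultimately have "\<tau> s = s"
    using bspec[OF s(3) \<tau>F] \<tau>sc by auto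
  then show "\<tau> \<in> weil_subgroup v F E"
    using bspec[OF s(4) \<tau>F] \<tau> inertia_subset unfolding weil_subgroup_def by blast
qed

end

end

(* Otherwise nested $ is also parsed as fps_nth, with exponentially many parse trees. *)
unbundle no Formal_Power_Series.fps_syntax

section \<open>Reduction of two-by-two matrices\<close>

lemma mat2_nth [simp]:
  "mat2 a b c d $ 1 $ 1 = a" "mat2 a b c d $ 1 $ 2 = b"
  "mat2 a b c d $ 2 $ 1 = c" "mat2 a b c d $ 2 $ 2 = d"
  by (simp_all add: mat2_def)

lemma mat_eq_iff2: "A = B \<longleftrightarrow> A $ 1 $ 1 = B $ 1 $ 1 \<and> A $ 1 $ 2 = B $ 1 $ 2 \<and>
    A $ 2 $ 1 = B $ 2 $ 1 \<and> A $ 2 $ 2 = B $ 2 $ 2" for A B :: "'a^2^2"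
  by (auto simp: vec_eq_iff forall_2)

lemma mat2_eq_iff [simp]: "mat2 a b c d = mat2 a' b' c' d' \<longleftrightarrow> a = a' \<and> b = b' \<and> c = c' \<and> d = d'"
  by (simp add: mat_eq_iff2)

lemma mat2_mult: "mat2 a b c d ** mat2 a' b' c' d' =
    mat2 (a * a' + b * c') (a * b' + b * d') (c * a' + d * c') (c * b' + d * d')"
  for a :: "'a::semiring_1"
  by (simp add: mat_eq_iff2 matrix_matrix_mult_def sum_2)

lemma mat2_exhaust:
  obtains a b c d where "A = mat2 a b c d"
  using that[of "A $ 1 $ 1" "A $ 1 $ 2" "A $ 2 $ 1" "A $ 2 $ 2"] by (simp add: mat_eq_iff2)

lemma mat2_mult_vec_nth:
  "(mat2 a b c d *v u) $ 1 = a * u $ 1 + b * u $ 2"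
  "(mat2 a b c d *v u) $ 2 = c * u $ 1 + d * u $ 2"
  by (simp_all add: matrix_vector_mult_def sum_2)

lemma det_mat2: "det (mat2 a b c d) = a * d - b * c"
  by (simp add: det_2)

lemma mat2_GL2_over_iff:
  "mat2 a b c d \<in> GL2_over R \<longleftrightarrow> a \<in> R \<and> b \<in> R \<and> c \<in> R \<and> d \<in> R \<and> a * d - b * c \<in> units_in R"
  by (auto simp: GL2_over_def det_mat2 forall_2)

text \<open>\<open>matrix_inv\<close> is a choice among two-sided inverses; the explicit inverse
  shows that one exists and then cancels against it.\<close>

lemma matrix_inv_upper2:
  fixes a b d :: "'a::field"
  assumes "a \<noteq> 0" "d \<noteq> 0"
  shows "matrix_inv (mat2 a b 0 d) = mat2 (1 / a) (- (b / (a * d))) 0 (1 / d)"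
proof -
  let ?A = "mat2 a b 0 d" and ?B = "mat2 (1 / a) (- (b / (a * d))) 0 (1 / d)"
  have one: "mat 1 = mat2 1 0 0 (1 :: 'a)"
    by (simp add: mat_eq_iff2 mat_def)
  have AB: "?A ** ?B = mat 1" "?B ** ?A = mat 1"
    using assms by (simp_all add: mat2_mult one)
  then have "?A ** matrix_inv ?A = mat 1"
    unfolding matrix_inv_def by (rule someI2[where a = "?B", OF conjI, THEN conjunct1]) auto
  then have "?B ** (?A ** matrix_inv ?A) = ?B"
    by simp
  then show ?thesis
    using AB by (simp add: matrix_mul_assoc)
qed

lemma reduce_rep_mat2: "\<rho> g = mat2 a b c d \<Longrightarrow>
    reduce_rep red \<rho> g = mat2 (red a) (red b) (red c) (red d)"
  by (simp add: reduce_rep_def mat_eq_iff2)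

lemma units_in_UNIV: "units_in UNIV = {x. x \<noteq> 0}"
  by (auto simp: units_in_def)

section \<open>Reduction modulo the maximal ideal of \<open>K\<close>\<close>

locale residue_reduction = ultrametric_abs w + subfield_type K
  for w :: "'l::field \<Rightarrow> real" and K +
  fixes red :: "'l \<Rightarrow> 'k::field"
  assumes reduction: "reduction_map w K red"
begin

abbreviation "V \<equiv> val_ring w K"

lemma V_iff: "x \<in> V \<longleftrightarrow> x \<in> K \<and> w x \<le> 1"
  by (simp add: val_ring_def)

lemma V_0 [simp]: "0 \<in> V" and V_1 [simp]: "1 \<in> V"
  by (simp_all add: V_iff mem_0 mem_1)

lemma V_add [intro]: "x \<in> V \<Longrightarrow> y \<in> V \<Longrightarrow> x + y \<in> V"
  and V_mult [intro]: "x \<in> V \<Longrightarrow> y \<in> V \<Longrightarrow> x * y \<in> V"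
  and V_diff [intro]: "x \<in> V \<Longrightarrow> y \<in> V \<Longrightarrow> x - y \<in> V"
  and V_minus [intro]: "x \<in> V \<Longrightarrow> - x \<in> V"
  by (auto simp: V_iff mem_add mem_mult mem_diff mem_minus add_le diff_le mult_le_1)

lemma V_minus_iff [simp]: "- x \<in> V \<longleftrightarrow> x \<in> V"
  using V_minus[of x] V_minus[of "- x"] by auto

lemma V_of_nat [simp]: "of_nat n \<in> V"
  by (induction n) auto

lemma red_add: "x \<in> V \<Longrightarrow> y \<in> V \<Longrightarrow> red (x + y) = red x + red y"
  and red_mult: "x \<in> V \<Longrightarrow> y \<in> V \<Longrightarrow> red (x * y) = red x * red y"
  and red_1: "red 1 = 1"
  and red_0_iff: "x \<in> V \<Longrightarrow> red x = 0 \<longleftrightarrow> w x < 1"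
  using reduction
  by (auto simp: reduction_map_def ring_hom_def val_ideal_def V_iff image_iff set_eq_iff)

lemma red_surj: "\<exists>x\<in>V. red x = z"
proof -
  have "z \<in> red ` V"
    using reduction by (simp add: reduction_map_def)
  then show ?thesis by auto
qed

lemma red_0: "red 0 = 0"
  by (simp add: red_0_iff)

lemma red_minus: "x \<in> V \<Longrightarrow> red (- x) = - red x"
  using red_add[of x "- x"] by (simp add: red_0 V_minus eq_neg_iff_add_eq_0 add.commute)

lemma red_diff: "x \<in> V \<Longrightarrow> y \<in> V \<Longrightarrow> red (x - y) = red x - red y"
  using red_add[of x "- y"] by (simp add: V_minus red_minus)

lemma red_of_nat: "red (of_nat n) = of_nat n"
  by (induction n) (simp_all add: red_0 red_1 red_add)

lemma cong_iff:
  assumes "x \<in> V" "y \<in> V"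
  shows "cong_val w K x y \<longleftrightarrow> red x = red y"
proof -
  have "x - y \<in> V" using assms by blast
  then have "cong_val w K x y \<longleftrightarrow> red (x - y) = 0"
    by (auto simp: cong_val_def val_ideal_def red_0_iff V_iff)
  then show ?thesis
    using assms by (simp add: red_diff)
qed

lemma red_eq_iff_less: "x \<in> V \<Longrightarrow> y \<in> V \<Longrightarrow> red x = red y \<longleftrightarrow> w (x - y) < 1"
  using red_0_iff[of "x - y"] by (auto simp: red_diff)

lemma cong_val_V: "cong_val w K x y \<Longrightarrow> y \<in> V \<Longrightarrow> x \<in> V"
  using V_add[of "x - y" y] by (auto simp: cong_val_def val_ideal_def V_iff)

lemma cong_val_sym: "cong_val w K x y \<Longrightarrow> cong_val w K y x"
  using mem_minus[of "x - y"] minus_commute[of x y] by (simp add: cong_val_def val_ideal_def)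

lemma red_nonzero_iff: "x \<in> V \<Longrightarrow> red x \<noteq> 0 \<longleftrightarrow> w x = 1"
  by (auto simp: red_0_iff V_iff)

lemma units_V_iff: "x \<in> units_in V \<longleftrightarrow> x \<in> V \<and> red x \<noteq> 0"
proof -
  have "w x = 1" if "w x \<le> 1" "inverse (w x) \<le> 1" "x \<noteq> 0"
    using that eq_0[of x] nonneg[of x] by (simp add: inverse_le_1_iff)
  then show ?thesis
    by (auto simp: units_in_def red_0_iff V_iff inv mem_inverse)
qed

lemma red_inverse:
  assumes "x \<in> V" "red x \<noteq> 0"
  shows "inverse x \<in> V" "red (inverse x) = inverse (red x)"
proof -
  show *: "inverse x \<in> V"
    using assms units_V_iff[of x] by (simp add: units_in_def)
  have "x \<noteq> 0" using assms by (auto simp: red_0)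
  then have "red x * red (inverse x) = 1"
    using red_mult[OF assms(1) *] by (simp add: red_1)
  then show "red (inverse x) = inverse (red x)"
    by (simp add: inverse_unique)
qed

lemma red_divide:
  assumes "x \<in> V" "y \<in> V" "red y \<noteq> 0"
  shows "x / y \<in> V" "red (x / y) = red x / red y"
  using assms red_inverse[of y] by (auto simp: divide_inverse red_mult)

lemma red_power_int:
  assumes "x \<in> V" "red x \<noteq> 0"
  shows "x powi k \<in> V \<and> red (x powi k) = red x powi k"
proof -
  have nat: "x ^ n \<in> V \<and> red (x ^ n) = red x ^ n" if "x \<in> V" for x n
    by (induction n) (use that in \<open>auto simp: red_1 red_mult\<close>)
  show ?thesis
    using nat[of x] nat[of "inverse x"] red_inverse[OF assms] assms
    by (auto simp: power_int_def)
qed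

end

section \<open>Isomorphism and indecomposability in dimension two\<close>

lemma reps_isomorphic_iff:
  "reps_isomorphic G r r' \<longleftrightarrow> (\<exists>a b c d. a * d - b * c \<noteq> 0 \<and>
     (\<forall>g\<in>G. r g ** mat2 a b c d = mat2 a b c d ** r' g))"
proof -
  have "(\<exists>P\<in>GL2_over UNIV. Q P) \<longleftrightarrow> (\<exists>a b c d. a * d - b * c \<noteq> 0 \<and> Q (mat2 a b c d))"
    for Q :: "'b^2^2 \<Rightarrow> bool"
  proof safe
    fix P assume "P \<in> GL2_over UNIV" "Q P"
    then show "\<exists>a b c d. a * d - b * c \<noteq> 0 \<and> Q (mat2 a b c d)"
      by (cases P rule: mat2_exhaust) (auto simp: mat2_GL2_over_iff units_in_UNIV)
  qed (auto simp: mat2_GL2_over_iff units_in_UNIV)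
  then show ?thesis
    by (simp add: reps_isomorphic_def)
qed

text \<open>Every nonzero invariant subspace contains the only eigenline of \<open>r g\<close>, so
  two of them cannot meet in zero.\<close>

lemma indecomposable_if_unipotent:
  assumes g: "g \<in> G" "r g = mat2 c d 0 c" and "d \<noteq> 0"
  shows "indecomposable G r"
  unfolding indecomposable_def
proof (intro notI, elim exE conjE)
  have e1: "axis 1 1 \<in> U" if U: "invariant_subspace G r U" "U \<noteq> {0}" for U
  proof -
    have sub: "vec.subspace U" and inv: "\<And>u. u \<in> U \<Longrightarrow> r g *v u \<in> U"
      using U g by (auto simp: invariant_subspace_def)
    obtain u where u: "u \<in> U" "u \<noteq> 0"
      using U(2) vec.subspace_0[OF sub] by blast
    show ?thesis
    proof (cases "u $ 2 = 0")
      case True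
      then have "inverse (u $ 1) *s u = axis 1 1"
        using u(2) by (simp add: vec_eq_iff forall_2 axis_def)
      then show ?thesis
        using vec.subspace_scale[OF sub u(1)] by metis
    next
      case False
      \<comment> \<open>Off the eigenline, \<open>r g\<close> minus the scalar \<open>c\<close>
        sends \<open>u\<close> to a nonzero multiple of the eigenvector.\<close>
      have eq: "r g *v u - c *s u = (d * u $ 2) *s axis 1 1"
        by (simp add: vec_eq_iff forall_2 axis_def g mat2_mult_vec_nth)
      have "inverse (d * u $ 2) *s (r g *v u - c *s u) = axis 1 1"
        unfolding eq using False \<open>d \<noteq> 0\<close> by (simp add: vec_eq_iff forall_2 axis_def field_simps)
      then show ?thesis
        using sub inv[OF u(1)] u(1) by (metis vec.subspace_diff vec.subspace_scale)
    qed
  qed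
  fix U U'
  assume "invariant_subspace G r U" "invariant_subspace G r U'" "U \<noteq> {0}" "U' \<noteq> {0}" "U \<inter> U' = {0}"
  then have "axis 1 1 = (0 :: 'b^2)"
    using e1 by blast
  then show False
    by (simp add: axis_eq_0_iff)
qed

section \<open>Comparing the two reductions\<close>

text \<open>
  \<open>G\<close> and \<open>H\<close> stand for \<open>W\<^sub>F\<close> and \<open>W\<^sub>E\<close>, and \<open>dec g s\<close> for: \<open>g = \<Phi>\<^sup>k \<tau>\<close> with \<open>\<tau>\<close> in the inertia
  group and \<open>s = t \<tau>\<close>.
\<close>
locale residual_pair = residue_reduction w K red + group G
  for w :: "'l::field \<Rightarrow> real" and K and red :: "'l \<Rightarrow> 'k::field" and G (structure) +
  fixes H :: "'a set" and \<sigma> \<Phi> :: 'a and chi \<omega> \<xi> :: "'a \<Rightarrow> 'l" and \<rho>1 \<rho>2 :: "'a \<Rightarrow> 'l^2^2"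
    and dec :: "'a \<Rightarrow> 'l \<Rightarrow> bool" and a1 b1 d1 a2 b2 d2 :: 'l and q :: nat
  assumes H_sub: "H \<subseteq> carrier G"
    and parity: "g \<in> carrier G \<Longrightarrow> h \<in> carrier G \<Longrightarrow> g \<otimes> h \<in> H \<longleftrightarrow> (g \<in> H \<longleftrightarrow> h \<in> H)"
    and \<sigma>: "\<sigma> \<in> carrier G" "\<sigma> \<notin> H"
    and Phi: "\<Phi> \<in> carrier G" "\<Phi> \<notin> H" "\<omega> \<Phi> = inverse (of_nat q)"
    and omega: "g \<in> carrier G \<Longrightarrow> \<exists>k. \<omega> g = of_nat q powi (- k) \<and> (g \<in> H \<longleftrightarrow> even k)"
    and chi_mult: "g \<in> carrier G \<Longrightarrow> h \<in> carrier G \<Longrightarrow> chi (g \<otimes> h) = chi g * chi h"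
    and xi_one: "\<xi> \<one> = 1"
    and rho1_mult: "g \<in> carrier G \<Longrightarrow> h \<in> carrier G \<Longrightarrow> \<rho>1 (g \<otimes> h) = \<rho>1 g ** \<rho>1 h"
    and rho2_mult: "g \<in> carrier G \<Longrightarrow> h \<in> carrier G \<Longrightarrow> \<rho>2 (g \<otimes> h) = \<rho>2 g ** \<rho>2 h"
    and rho1_int: "g \<in> carrier G \<Longrightarrow> \<rho>1 g \<in> GL2_over V"
    and rho2_int: "g \<in> carrier G \<Longrightarrow> \<rho>2 g \<in> GL2_over V"
    and U1: "a1 \<in> K" "b1 \<in> K" "d1 \<in> K" "a1 \<noteq> 0" "d1 \<noteq> 0"
    and U2: "b2 \<in> K" "d2 \<in> K" "a2 / d2 \<in> units_in V"
    and rho1_H: "h \<in> H \<Longrightarrow> \<rho>1 h =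
      mat2 (\<xi> h) (b1 / d1 * (\<xi> (\<sigma> \<otimes> h \<otimes> inv \<sigma>) - \<xi> h)) 0 (\<xi> (\<sigma> \<otimes> h \<otimes> inv \<sigma>))"
    and rho1_nH: "g \<in> carrier G \<Longrightarrow> g \<notin> H \<Longrightarrow> y = \<xi> (\<sigma> \<otimes> (g \<otimes> inv \<sigma>) \<otimes> \<sigma>) \<Longrightarrow> \<rho>1 g =
      mat2 (b1 * y / a1) (a1 * \<xi> (g \<otimes> inv \<sigma>) / d1 - b1 * b1 * y / (a1 * d1))
        (d1 * y / a1) (- (b1 * y / a1))"
    and dec_carrier: "dec g s \<Longrightarrow> g \<in> carrier G"
    and dec_V: "dec g s \<Longrightarrow> s \<in> V"
    and dec_ex: "g \<in> carrier G \<Longrightarrow> \<exists>s. dec g s"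
    and dec_1: "\<exists>\<tau>\<in>H. dec \<tau> 1 \<and> \<omega> \<tau> = 1"
    and rho2_dec: "dec g s \<Longrightarrow> \<rho>2 g =
      mat2 (chi g * \<omega> g) (a2 / d2 * s * (chi g * \<omega> g) + b2 / d2 * (chi g - chi g * \<omega> g)) 0 (chi g)"
    and two: "(2 :: 'k) \<noteq> 0"
begin

abbreviation xi_conj where "xi_conj h \<equiv> \<xi> (\<sigma> \<otimes> h \<otimes> inv \<sigma>)"
abbreviation "r1 \<equiv> reduce_rep red \<rho>1"
abbreviation "r2 \<equiv> reduce_rep red \<rho>2"
abbreviation "u \<equiv> a2 / d2"

lemma H_carrier: "h \<in> H \<Longrightarrow> h \<in> carrier G"
  using H_sub by auto

lemma one_H: "\<one> \<in> H"
  using parity[of \<one> \<one>] by simp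

lemma inv_H: "g \<in> carrier G \<Longrightarrow> inv g \<in> H \<longleftrightarrow> g \<in> H"
  using parity[of g "inv g"] one_H by simp

lemma conj_H: "h \<in> H \<Longrightarrow> \<sigma> \<otimes> h \<otimes> inv \<sigma> \<in> H"
  using \<sigma> H_carrier[of h] by (simp add: parity inv_H)

lemma u_V: "u \<in> V" "red u \<noteq> 0"
  using U2 by (simp_all add: units_V_iff)

section \<open>Integrality and reduction of the two representations\<close>

lemma rho1_mat2_V:
  assumes "g \<in> carrier G" "\<rho>1 g = mat2 a b c d"
  shows "a \<in> V" "b \<in> V" "c \<in> V" "d \<in> V" "a * d - b * c \<in> units_in V"
  using rho1_int[OF assms(1)] by (simp_all add: assms(2) mat2_GL2_over_iff)

lemma rho2_mat2_V:
  assumes "g \<in> carrier G" "\<rho>2 g = mat2 a b c d"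
  shows "a \<in> V" "b \<in> V" "c \<in> V" "d \<in> V" "a * d - b * c \<in> units_in V"
  using rho2_int[OF assms(1)] by (simp_all add: assms(2) mat2_GL2_over_iff)

text \<open>\<open>chi g * \<omega> g\<close> and \<open>chi g\<close> are the diagonal entries of a
  triangular integral matrix with unit determinant, so both are units, and so is their
  quotient.\<close>

lemma chi_V:
  assumes g: "g \<in> carrier G"
  shows "chi g \<in> V" "red (chi g) \<noteq> 0" "\<omega> g \<in> V" "red (\<omega> g) \<noteq> 0"
proof -
  obtain s where s: "dec g s"
    using dec_ex[OF g] by blast
  note V = rho2_mat2_V[OF g rho2_dec[OF s]]
  show chi: "chi g \<in> V" by (fact V)
  have *: "chi g * \<omega> g \<in> V" by (fact V)
  have "red (chi g * \<omega> g * chi g) \<noteq> 0"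
    using V(5) by (simp add: units_V_iff)
  then have nz: "red (chi g * \<omega> g) * red (chi g) \<noteq> 0"
    using red_mult[OF * chi] by simp
  then show "red (chi g) \<noteq> 0" by simp
  then have "chi g \<noteq> 0" by (auto simp: red_0)
  then have "\<omega> g = chi g * \<omega> g / chi g" by simp
  then show "\<omega> g \<in> V"
    using red_divide(1)[OF * chi] \<open>red (chi g) \<noteq> 0\<close> by simp
  then show "red (\<omega> g) \<noteq> 0"
    using nz red_mult[OF chi] by auto
qed

text \<open>The last claim concerns the off-diagonal entry as a whole: it is integral even where
  \<open>b1 / d1\<close> is not.\<close>

lemma xi_V:
  assumes h: "h \<in> H"
  shows "\<xi> h \<in> V" "red (\<xi> h) \<noteq> 0" "xi_conj h \<in> V" "red (xi_conj h) \<noteq> 0"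
    "b1 / d1 * (xi_conj h - \<xi> h) \<in> V"
proof -
  note V = rho1_mat2_V[OF H_carrier[OF h] rho1_H[OF h]]
  show *: "\<xi> h \<in> V" "xi_conj h \<in> V" "b1 / d1 * (xi_conj h - \<xi> h) \<in> V"
    by (fact V)+
  have "red (\<xi> h * xi_conj h) \<noteq> 0"
    using V(5) by (simp add: units_V_iff)
  then show "red (\<xi> h) \<noteq> 0" "red (xi_conj h) \<noteq> 0"
    using red_mult[OF *(1,2)] by auto
qed

lemma r1_H:
  assumes "h \<in> H"
  shows "r1 h = mat2 (red (\<xi> h)) (red (b1 / d1 * (xi_conj h - \<xi> h))) 0 (red (xi_conj h))"
  using reduce_rep_mat2[where red = red and \<rho> = \<rho>1, OF rho1_H[OF assms]] by (simp add: red_0)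

lemma r2_dec:
  assumes "dec g s"
  shows "r2 g = mat2 (red (chi g) * red (\<omega> g))
    (red (u * s * (chi g * \<omega> g) + b2 / d2 * (chi g - chi g * \<omega> g))) 0 (red (chi g))"
  using reduce_rep_mat2[where red = red and \<rho> = \<rho>2, OF rho2_dec[OF assms]]
    chi_V[OF dec_carrier[OF assms]] by (simp add: red_0 red_mult)

lemma r1_mult:
  assumes "g \<in> carrier G" "h \<in> carrier G"
  shows "r1 (g \<otimes> h) = r1 g ** r1 h"
proof -
  obtain a b c d a' b' c' d' where eq: "\<rho>1 g = mat2 a b c d" "\<rho>1 h = mat2 a' b' c' d'"
    using mat2_exhaust by metis
  show ?thesis
    using rho1_mat2_V[OF assms(1) eq(1)] rho1_mat2_V[OF assms(2) eq(2)] rho1_mult[OF assms]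
    by (simp add: eq mat2_mult reduce_rep_mat2 red_add red_mult V_mult)
qed

lemma r2_mult:
  assumes "g \<in> carrier G" "h \<in> carrier G"
  shows "r2 (g \<otimes> h) = r2 g ** r2 h"
proof -
  obtain a b c d a' b' c' d' where eq: "\<rho>2 g = mat2 a b c d" "\<rho>2 h = mat2 a' b' c' d'"
    using mat2_exhaust by metis
  show ?thesis
    using rho2_mat2_V[OF assms(1) eq(1)] rho2_mat2_V[OF assms(2) eq(2)] rho2_mult[OF assms]
    by (simp add: eq mat2_mult reduce_rep_mat2 red_add red_mult V_mult)
qed

text \<open>Since \<open>\<omega> \<tau> = 1\<close>, the \<open>b2 / d2\<close> term vanishes
  before reduction, so integrality of \<open>b2 / d2\<close> does not enter; the off-diagonal entry
  that remains is a unit.\<close>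

lemma r2_unipotent:
  obtains \<tau> where "\<tau> \<in> H" "dec \<tau> 1" "\<omega> \<tau> = 1"
    "r2 \<tau> = mat2 (red (chi \<tau>)) (red u * red (chi \<tau>)) 0 (red (chi \<tau>))"
proof -
  obtain \<tau> where \<tau>: "\<tau> \<in> H" "dec \<tau> 1" "\<omega> \<tau> = 1"
    using dec_1 by blast
  then show thesis
    using that[OF \<tau>] r2_dec[OF \<tau>(2)] chi_V[OF H_carrier[OF \<tau>(1)]] u_V
    by (simp add: red_1 red_mult del: times_divide_eq_left times_divide_eq_right)
qed

lemma r2_indecomposable: "indecomposable (carrier G) r2"
  using r2_unipotent chi_V u_V H_carrier indecomposable_if_unipotent
  by (metis mult_eq_0_iff)

lemma red_omega:
  assumes q: "red (of_nat q) = - 1" and g: "g \<in> carrier G"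
  shows "red (\<omega> g) = (if g \<in> H then 1 else - 1)"
proof -
  obtain k where k: "\<omega> g = of_nat q powi (- k)" "g \<in> H \<longleftrightarrow> even k"
    using omega[OF g] by blast
  have "red (\<omega> g) = (- 1) powi (- k)"
    using red_power_int[of "of_nat q" "- k"] q by (simp add: k)
  then show ?thesis
    using k(2) by (cases "even k") (auto simp: power_int_minus_left)
qed

text \<open>
  At \<open>\<Phi>\<close> the factor \<open>chi - chi * \<omega>\<close> reduces to \<open>2 * chi\<close>, a unit, so integrality of \<open>\<rho>2 \<Phi>\<close>
  forces that of \<open>b2 / d2\<close>.
\<close>
lemma b2_V:
  assumes q: "red (of_nat q) = - 1"
  shows "b2 / d2 \<in> V"
proof -
  obtain s where s: "dec \<Phi> s"
    using dec_ex[OF Phi(1)] by blast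
  note chi = chi_V[OF Phi(1)]
  define m where "m = chi \<Phi> - chi \<Phi> * \<omega> \<Phi>"
  have m: "m \<in> V"
    using chi by (auto simp: m_def)
  have "red m = 2 * red (chi \<Phi>)"
    using chi red_omega[OF q Phi(1)] Phi(2) by (simp add: m_def red_diff red_mult V_mult)
  then have red_m: "red m \<noteq> 0"
    using chi two by simp
  have "u * s * (chi \<Phi> * \<omega> \<Phi>) + b2 / d2 * m \<in> V"
    using rho2_mat2_V(2)[OF Phi(1) rho2_dec[OF s]] by (simp add: m_def)
  moreover have "u * s * (chi \<Phi> * \<omega> \<Phi>) \<in> V"
    by (intro V_mult u_V dec_V[OF s] chi)
  ultimately have "b2 / d2 * m \<in> V"
    using V_diff by fastforce
  moreover have "m \<noteq> 0"
    using red_m by (auto simp: red_0)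
  ultimately show ?thesis
    using red_divide(1)[OF _ m red_m, of "b2 / d2 * m"] by simp
qed

text \<open>On \<open>H\<close> the factor \<open>chi - chi * \<omega>\<close> reduces to zero, and
  by integrality of \<open>b2 / d2\<close> the whole term disappears.\<close>

lemma r2_H:
  assumes q: "red (of_nat q) = - 1" and h: "h \<in> H" and s: "dec h s"
  shows "r2 h = mat2 (red (chi h)) (red u * red s * red (chi h)) 0 (red (chi h))"
proof -
  note chi = chi_V[OF H_carrier[OF h]]
  have "red (\<omega> h) = 1"
    using red_omega[OF q H_carrier[OF h]] h by simp
  then show ?thesis
    using r2_dec[OF s] chi u_V dec_V[OF s] b2_V[OF q]
    by (simp add: red_add red_mult red_diff V_mult V_diff
        del: times_divide_eq_left times_divide_eq_right)
qed

text \<open>Quantifying over all \<open>s\<close> with \<open>dec h s\<close> avoids any appeal to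
  uniqueness of the decomposition of \<open>h\<close>.\<close>

definition x_condition :: "'l \<Rightarrow> bool" where
  "x_condition x \<longleftrightarrow> (\<forall>h\<in>H. \<forall>s. dec h s \<longrightarrow>
     cong_val w K (a2 * x / d2 * s * chi h) (b1 / d1 * (xi_conj h - \<xi> h)))"

lemma x_condition_iff:
  assumes x: "x \<in> V"
  shows "x_condition x \<longleftrightarrow> (\<forall>h\<in>H. \<forall>s. dec h s \<longrightarrow>
     red u * red x * red s * red (chi h) = red (b1 / d1 * (xi_conj h - \<xi> h)))"
proof -
  have "cong_val w K (a2 * x / d2 * s * chi h) (b1 / d1 * (xi_conj h - \<xi> h)) \<longleftrightarrow>
     red u * red x * red s * red (chi h) = red (b1 / d1 * (xi_conj h - \<xi> h))"
    if "h \<in> H" "dec h s" for h s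
  proof -
    have "a2 * x / d2 = u * x" by simp
    then show ?thesis
      using x u_V dec_V[OF that(2)] chi_V[OF H_carrier[OF that(1)]] xi_V[OF that(1)]
      by (simp only: cong_iff red_mult V_mult)
  qed
  then show ?thesis
    by (auto simp: x_condition_def)
qed

text \<open>
  The element \<open>\<tau>\<close> with \<open>dec \<tau> 1\<close> reduces to a nontrivial Jordan block under \<open>r2\<close> and to an upper
  triangular matrix under \<open>r1\<close>; matching the eigenlines makes any intertwiner upper triangular.
\<close>
lemma iso_upper_triangular:
  assumes "reps_isomorphic (carrier G) r1 r2"
  obtains a b d where "a \<noteq> 0" "d \<noteq> 0"
    "\<forall>g\<in>carrier G. r1 g ** mat2 a b 0 d = mat2 a b 0 d ** r2 g"
proof -
  obtain a b c d where det: "a * d - b * c \<noteq> 0"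
    and eq: "\<forall>g\<in>carrier G. r1 g ** mat2 a b c d = mat2 a b c d ** r2 g"
    using assms by (auto simp: reps_isomorphic_iff)
  obtain \<tau> where \<tau>: "\<tau> \<in> H"
    "r2 \<tau> = mat2 (red (chi \<tau>)) (red u * red (chi \<tau>)) 0 (red (chi \<tau>))"
    using r2_unipotent by metis
  have "red (xi_conj \<tau>) * c = c * red (chi \<tau>)"
    "red (xi_conj \<tau>) * d = c * (red u * red (chi \<tau>)) + d * red (chi \<tau>)"
    using bspec[OF eq H_carrier[OF \<tau>(1)]] by (simp_all add: r1_H[OF \<tau>(1)] \<tau>(2) mat2_mult)
  then have "c = 0"
    using chi_V(2)[OF H_carrier[OF \<tau>(1)]] u_V by (cases "c = 0") auto
  then show thesis
    using that[of a d b] det eq by simp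
qed

section \<open>Behaviour at \<sigma> and the two directions of the equivalence\<close>

lemma r1_sigma:
  defines "y \<equiv> \<xi> (\<sigma> \<otimes> \<sigma>)"
  shows "\<rho>1 \<sigma> = mat2 (b1 * y / a1) (a1 / d1 - b1 * b1 * y / (a1 * d1))
        (d1 * y / a1) (- (b1 * y / a1))"
  using rho1_nH[OF \<sigma> refl] \<sigma> by (simp add: xi_one y_def)

lemma sigma_sq_H: "\<sigma> \<otimes> \<sigma> \<in> H"
  using \<sigma> by (simp add: parity)

lemma iso_imp:
  assumes "reps_isomorphic (carrier G) r1 r2"
  shows "red (of_nat q) = - 1" "\<forall>h\<in>H. red (chi h) = red (\<xi> h)" "b1 \<noteq> 0"
    "cong_val w K (chi \<sigma>) (- (a1 / b1))" "\<exists>x\<in>units_in V. x_condition x"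
proof -
  obtain a b d where ad: "a \<noteq> 0" "d \<noteq> 0"
    and eq: "\<forall>g\<in>carrier G. r1 g ** mat2 a b 0 d = mat2 a b 0 d ** r2 g"
    by (rule iso_upper_triangular[OF assms])
  \<comment> \<open>The lower left entry of the intertwining equation forces \<open>C = 0\<close>;
    then the diagonal entries compare directly.\<close>
  have diag: "A = red (chi g) * red (\<omega> g) \<and> D = red (chi g)"
    if g: "g \<in> carrier G" "r1 g = mat2 A B C D" for g A B C D
  proof -
    obtain s where "dec g s"
      using dec_ex[OF g(1)] by blast
    then show ?thesis
      using bspec[OF eq g(1)] ad by (auto simp: g(2) r2_dec mat2_mult)
  qed
  \<comment> \<open>Outside \<open>H\<close> the matrix of \<open>\<rho>1\<close> has trace zero, so
    \<open>chi * \<omega>\<close> and \<open>- chi\<close> have the same reduction.\<close>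
  have off: "red (\<omega> g) = - 1" if g: "g \<in> carrier G" "g \<notin> H" for g
  proof -
    note rho = rho1_nH[OF g refl]
    note V = rho1_mat2_V[OF g(1) rho]
    show ?thesis
      using diag[OF g(1) reduce_rep_mat2[where red = red and \<rho> = \<rho>1, OF rho]] V(1) chi_V(2)[OF g(1)]
      by (simp add: red_minus minus_equation_iff) (metis mult.right_neutral mult_cancel_left mult_minus_right)
  qed
  have "red (\<omega> \<Phi>) = - 1"
    by (rule off[OF Phi(1,2)])
  \<comment> \<open>As \<open>inverse 0 = 0\<close>, the case \<open>of_nat q = 0\<close> must be
    excluded; it would make the reduction of \<open>\<omega> \<Phi>\<close> vanish.\<close>
  moreover have "red (of_nat q) * red (\<omega> \<Phi>) = 1"
  proof -
    have "of_nat q \<noteq> (0 :: 'l)"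
      using chi_V(4)[OF Phi(1)] Phi(3) by (auto simp: red_0)
    then show ?thesis
      using red_mult[of "of_nat q" "\<omega> \<Phi>"] chi_V(3)[OF Phi(1)] Phi(3) by (simp add: red_1)
  qed
  ultimately show q: "red (of_nat q) = - 1"
    by (simp add: minus_equation_iff)
  have H_eq: "red (\<xi> h) = red (chi h)" "red (xi_conj h) = red (chi h)" if h: "h \<in> H" for h
    using diag[OF H_carrier[OF h] r1_H[OF h]] red_omega[OF q H_carrier[OF h]] h by auto
  then show "\<forall>h\<in>H. red (chi h) = red (\<xi> h)"
    by simp
  define y where "y = \<xi> (\<sigma> \<otimes> \<sigma>)"
  note rho = r1_sigma[folded y_def]
  note V = rho1_mat2_V[OF \<sigma>(1) rho] and chi = chi_V[OF \<sigma>(1)]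
  have y: "y \<in> V" "red y = red (chi \<sigma>) * red (chi \<sigma>)"
    using xi_V(1)[OF sigma_sq_H] H_eq(1)[OF sigma_sq_H] chi
    by (simp_all add: y_def chi_mult[OF \<sigma>(1) \<sigma>(1)] red_mult)
  have b1y: "red (b1 * y / a1) = - red (chi \<sigma>)"
    using diag[OF \<sigma>(1) reduce_rep_mat2[where red = red and \<rho> = \<rho>1, OF rho]] off[OF \<sigma>] by simp
  then have nz: "red (b1 * y / a1) \<noteq> 0" using chi by simp
  then have "b1 * y / a1 \<noteq> 0" by (auto simp: red_0)
  then show b1: "b1 \<noteq> 0" by auto
  \<comment> \<open>The numerator reduces to the square of \<open>chi \<sigma>\<close> and the
    denominator to its negative, which gives the reduction of \<open>a1 / b1\<close>.\<close>
  have ab: "a1 / b1 = y / (b1 * y / a1)"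
    using \<open>b1 * y / a1 \<noteq> 0\<close> by auto
  have "a1 / b1 \<in> V" "red (a1 / b1) = - red (chi \<sigma>)"
    unfolding ab using red_divide[OF y(1) V(1) nz] chi by (simp_all add: y(2) b1y)
  then show "cong_val w K (chi \<sigma>) (- (a1 / b1))"
    using chi by (simp add: cong_iff red_minus)
  \<comment> \<open>A lift of the ratio of the diagonal entries of the intertwiner. On
    \<open>H\<close> both reductions have scalar diagonal, so \<open>b\<close> cancels and the upper
    right entry becomes the condition on \<open>x\<close>.\<close>
  obtain x where x: "x \<in> V" "red x = a / d"
    using red_surj by blast
  have "red u * red x * red s * red (chi h) = red (b1 / d1 * (xi_conj h - \<xi> h))"
    if h: "h \<in> H" and s: "dec h s" for h s
    using bspec[OF eq H_carrier[OF h]] ad H_eq[OF h]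
    by (simp add: r1_H[OF h] r2_H[OF q h s] mat2_mult x(2) field_simps)
  then have "x_condition x"
    by (simp add: x_condition_iff[OF x(1)])
  moreover have "x \<in> units_in V"
    using x ad by (simp add: units_V_iff)
  ultimately show "\<exists>x\<in>units_in V. x_condition x"
    by blast
qed

lemma iso_if:
  assumes q: "red (of_nat q) = - 1" and chi_xi: "\<forall>h\<in>H. red (chi h) = red (\<xi> h)" and b1: "b1 \<noteq> 0"
    and chi_\<sigma>: "cong_val w K (chi \<sigma>) (- (a1 / b1))" and x: "x \<in> units_in V" "x_condition x"
  shows "reps_isomorphic (carrier G) r1 r2"
proof -
  have xV: "x \<in> V" "red x \<noteq> 0"
    using x by (simp_all add: units_V_iff)
  note xc = x_condition_iff[THEN iffD1, OF xV(1) x(2), rule_format]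
  \<comment> \<open>\<open>chi\<close> is a character of all of \<open>G\<close>, hence invariant
    under conjugation by \<sigma>; the congruence with \<xi> transfers this invariance to the
    reduction of \<xi>.\<close>
  have xi_conj: "red (xi_conj h) = red (chi h)" if h: "h \<in> H" for h
  proof -
    have hc: "\<sigma> \<otimes> h \<in> carrier G" "h \<in> carrier G" "inv \<sigma> \<in> carrier G"
      using \<sigma> H_carrier[OF h] by simp_all
    have "chi \<one> * chi \<one> = chi \<one>"
      using chi_mult[of \<one> \<one>] by simp
    moreover have "chi \<one> \<noteq> 0"
      using chi_V(2)[of \<one>] by (auto simp: red_0)
    ultimately have one: "chi \<sigma> * chi (inv \<sigma>) = 1"
      using chi_mult[OF \<sigma>(1) hc(3)] \<sigma>(1) by simp
    have "chi (\<sigma> \<otimes> h \<otimes> inv \<sigma>) = chi \<sigma> * chi h * chi (inv \<sigma>)"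
      using chi_mult[OF hc(1,3)] chi_mult[OF \<sigma>(1) hc(2)] by simp
    also have "\<dots> = chi h"
      using one by (simp add: mult_ac)
    finally show ?thesis
      using chi_xi conj_H[OF h] by metis
  qed
  define y where "y = \<xi> (\<sigma> \<otimes> \<sigma>)"
  note rho = r1_sigma[folded y_def]
  note V = rho1_mat2_V[OF \<sigma>(1) rho] and chi = chi_V[OF \<sigma>(1)]
  have y: "y \<in> V" "red y = red (chi \<sigma>) * red (chi \<sigma>)"
    using xi_V(1)[OF sigma_sq_H] chi_xi sigma_sq_H chi
    by (simp_all add: y_def red_mult flip: chi_mult[OF \<sigma>(1) \<sigma>(1)])
      (metis chi_mult[OF \<sigma>(1) \<sigma>(1)] red_mult)
  \<comment> \<open>A congruence only bounds the difference; integrality of \<open>a1 / b1\<close>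
    is inherited from \<open>chi \<sigma>\<close>.\<close>
  have "cong_val w K (- (a1 / b1)) (chi \<sigma>)"
    by (rule cong_val_sym[OF chi_\<sigma>])
  then have "- (a1 / b1) \<in> V"
    using cong_val_V chi by blast
  then have ab: "a1 / b1 \<in> V" "red (a1 / b1) = - red (chi \<sigma>)"
    using chi_\<sigma> chi by (auto simp: cong_iff red_minus)
  have eq: "b1 * y / a1 = y / (a1 / b1)"
    by simp
  have b1y: "red (b1 * y / a1) = - red (chi \<sigma>)"
    unfolding eq using red_divide(2)[OF y(1) ab(1)] ab(2) chi y(2) by simp
  text \<open>The condition on \<open>x\<close> makes \<open>b1 / d1\<close> nonintegral, as \<open>\<xi>\<close> and its conjugate agree residually.\<close>
  have da: "red (d1 * y / a1) = 0"
  proof -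
    obtain \<tau> where \<tau>: "\<tau> \<in> H" "dec \<tau> 1"
      using dec_1 by blast
    have "red (b1 / d1 * (xi_conj \<tau> - \<xi> \<tau>)) \<noteq> 0"
      using xc[OF \<tau>] u_V xV chi_V(2)[OF H_carrier[OF \<tau>(1)]] by (metis red_1 mult_eq_0_iff one_neq_zero)
    then have "w (b1 / d1 * (xi_conj \<tau> - \<xi> \<tau>)) = 1"
      using red_nonzero_iff xi_V(5)[OF \<tau>(1)] by blast
    then have "w (b1 / d1) * w (xi_conj \<tau> - \<xi> \<tau>) = 1"
      by (simp only: mult)
    moreover have "w (xi_conj \<tau> - \<xi> \<tau>) < 1"
      using xi_V[OF \<tau>(1)] xi_conj[OF \<tau>(1)] chi_xi \<tau>(1) by (simp flip: red_eq_iff_less)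
    ultimately have "w (b1 / d1) > 1"
      by (metis mult.commute mult_left_le nonneg not_less)
    \<comment> \<open>As \<open>a1 / b1\<close> is a unit, \<open>a1 / d1\<close> has the same
      absolute value as \<open>b1 / d1\<close>, so the lower left entry of
      \<open>\<rho>1 \<sigma>\<close> lies in the maximal ideal.\<close>
    moreover have "w (a1 / b1) = 1"
      using red_nonzero_iff[OF ab(1)] ab(2) chi by simp
    moreover have "w (a1 / d1) = w (b1 / d1) * w (a1 / b1)"
      using b1 by (simp flip: mult)
    ultimately have "w (d1 / a1) < 1"
      using inv[of "a1 / d1"] by (simp add: inverse_less_1_iff)
    moreover have "w (d1 * y / a1) = w (d1 / a1) * w y"
      using mult[of "d1 / a1" y] by simp
    ultimately have "w (d1 * y / a1) < 1"
      using y(1) nonneg[of "d1 / a1"] by (metis V_iff mult_left_le order_le_less_trans)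
    then show ?thesis
      using red_0_iff[OF V(3)] by simp
  qed
  obtain s where s: "dec \<sigma> s"
    using dec_ex[OF \<sigma>(1)] by blast
  obtain e1 where r1\<sigma>: "r1 \<sigma> = mat2 (- red (chi \<sigma>)) e1 0 (red (chi \<sigma>))"
    using reduce_rep_mat2[where red = red and \<rho> = \<rho>1, OF rho] V(1) by (simp add: b1y da red_minus)
  obtain e2 where r2\<sigma>: "r2 \<sigma> = mat2 (- red (chi \<sigma>)) e2 0 (red (chi \<sigma>))"
    using r2_dec[OF s] red_omega[OF q \<sigma>(1)] \<sigma>(2) by simp
  \<comment> \<open>Solves the upper right entry of the intertwining equation at \<sigma>; its
    coefficient is \<open>2 * red (chi \<sigma>)\<close>, the difference of the two diagonal entries
    there.\<close>
  define b where "b = (e1 - red x * e2) / (2 * red (chi \<sigma>))"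
  let ?P = "mat2 (red x) b 0 1"
  have "2 * (red (chi \<sigma>) * b) = e1 - red x * e2"
    using two chi by (simp add: b_def)
  then have P\<sigma>: "r1 \<sigma> ** ?P = ?P ** r2 \<sigma>"
    by (simp add: r1\<sigma> r2\<sigma> mat2_mult) (simp add: algebra_simps)
  \<comment> \<open>With scalar diagonals on \<open>H\<close>, the value of \<open>b\<close> is
    irrelevant and the equation is the condition on \<open>x\<close>.\<close>
  have PH: "r1 h ** ?P = ?P ** r2 h" if h: "h \<in> H" for h
  proof -
    obtain s where s: "dec h s"
      using dec_ex[OF H_carrier[OF h]] by blast
    show ?thesis
      using xc[OF h s] xi_conj[OF h] bspec[OF chi_xi h]
      by (simp add: r1_H[OF h] r2_H[OF q h s] mat2_mult algebra_simps)
  qed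
  have "r1 g ** ?P = ?P ** r2 g" if g: "g \<in> carrier G" for g
  proof (cases "g \<in> H")
    case False
    \<comment> \<open>Outside \<open>H\<close>, \<open>g\<close> is an element of \<open>H\<close>
      times \<sigma>, and intertwining relations multiply.\<close>
    then have h: "g \<otimes> inv \<sigma> \<in> H" and hc: "g \<otimes> inv \<sigma> \<in> carrier G"
      using g \<sigma> by (simp_all add: parity inv_H)
    have "g \<otimes> inv \<sigma> \<otimes> \<sigma> = g"
      using g \<sigma> by (simp add: m_assoc)
    then show ?thesis
      using r1_mult[OF hc \<sigma>(1)] r2_mult[OF hc \<sigma>(1)] PH[OF h] P\<sigma>
      by (metis matrix_mul_assoc)
  qed (rule PH)
  then show ?thesis
    unfolding reps_isomorphic_iff using xV by (intro exI[of _ "red x"] exI[of _ b] exI[of _ 0] exI[of _ 1]) auto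
qed

theorem iso_iff:
  "reps_isomorphic (carrier G) r1 r2 \<longleftrightarrow>
     indecomposable (carrier G) r2 \<and> red (of_nat q) = - 1 \<and> (\<forall>h\<in>H. red (chi h) = red (\<xi> h)) \<and>
     b1 \<noteq> 0 \<and> cong_val w K (chi \<sigma>) (- (a1 / b1)) \<and> (\<exists>x\<in>units_in V. x_condition x)"
  using iso_imp iso_if r2_indecomposable by blast

end

section \<open>Parity of Frobenius exponents in the Weil group\<close>

declare mult_weil_group [simp del] one_weil_group [simp del]

text \<open>The parity law already puts the identity into \<open>H\<close> and makes membership
  invariant under inverses, so natural exponents suffice.\<close>

lemma (in group) int_pow_parity:
  assumes parity: "\<And>g h. g \<in> carrier G \<Longrightarrow> h \<in> carrier G \<Longrightarrow> g \<otimes> h \<in> H \<longleftrightarrow> (g \<in> H \<longleftrightarrow> h \<in> H)"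
    and x: "x \<in> carrier G" "x \<notin> H"
  shows "x [^] (k :: int) \<in> H \<longleftrightarrow> even k"
proof -
  have one: "\<one> \<in> H"
    using parity[of \<one> \<one>] by simp
  have nat: "x [^] n \<in> H \<longleftrightarrow> even n" for n :: nat
    using x by (induction n) (simp_all add: one parity)
  have inv: "inv g \<in> H \<longleftrightarrow> g \<in> H" if "g \<in> carrier G" for g
    using parity[of g "inv g"] one that by simp
  show ?thesis
    using nat x by (cases k rule: int_cases2) (simp_all add: int_pow_int int_pow_neg_int inv)
qed

context weil_frobenius
begin

lemma id_inertia: "id \<in> I"
  by (simp add: inertia_iff gal_id frob_degree_def)

lemma weil_elt_inertia:
  assumes "\<tau> \<in> I"
  shows "weil_elt v F \<Phi> 0 \<tau> = \<tau>"
  using assms inertia_subset by (auto simp: weil_elt_def)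

lemma weil_elt_Phi: "weil_elt v F \<Phi> 1 id = \<Phi>"
  using weil.r_one[OF Phi_carrier] Phi_carrier
  by (simp add: weil_elt_def one_weil_group weil.int_pow_1)

lemma weil_elt_carrier: "\<tau> \<in> I \<Longrightarrow> weil_elt v F \<Phi> k \<tau> \<in> carrier W"
  using inertia_subset Phi_carrier by (auto simp: weil_elt_def)

text \<open>Inertia lies in the subgroup, so only the power of \<Phi> matters. If \<Phi> lay in the
  subgroup, every element of the Weil group would, contrary to the choice of \<sigma>.\<close>

lemma weil_elt_parity:
  assumes "odd p" "quadratic_extension F E" "\<sigma> \<in> carrier W - weil_subgroup v F E"
    and unr: "unramified v F E" and \<tau>: "\<tau> \<in> I"
  shows "weil_elt v F \<Phi> k \<tau> \<in> weil_subgroup v F E \<longleftrightarrow> even k"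
proof -
  let ?H = "weil_subgroup v F E"
  note parity = weil_subgroup_parity[OF assms(1-3)]
  have I_H: "\<tau> \<in> ?H" if "\<tau> \<in> I" for \<tau>
    using inertia_subset_weil_subgroup[OF assms(1-3) unr] that by blast
  have eq: "weil_elt v F \<Phi> k \<tau> \<in> ?H \<longleftrightarrow> \<Phi> [^]\<^bsub>W\<^esub> k \<in> ?H" if "\<tau> \<in> I" for k \<tau>
    using that I_H inertia_subset Phi_carrier by (auto simp: weil_elt_def parity)
  have "\<Phi> \<notin> ?H"
  proof
    assume "\<Phi> \<in> ?H"
    have one: "\<one>\<^bsub>W\<^esub> \<in> ?H"
      using parity[OF weil.one_closed weil.one_closed] by simp
    have nat: "\<Phi> [^]\<^bsub>W\<^esub> n \<in> ?H" for n :: nat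
      using one \<open>\<Phi> \<in> ?H\<close> Phi_carrier by (induction n) (simp_all add: parity)
    have inv: "inv\<^bsub>W\<^esub> g \<in> ?H" if "g \<in> carrier W" "g \<in> ?H" for g
      using parity[of g "inv\<^bsub>W\<^esub> g"] one that by simp
    have "\<Phi> [^]\<^bsub>W\<^esub> k \<in> ?H" for k :: int
      using nat Phi_carrier
      by (cases k rule: int_cases2) (simp_all add: int_pow_int weil.int_pow_neg_int inv)
    then have "g \<in> ?H" if "g \<in> carrier W" for g
      using weil_elt_exhaust[OF that] eq by metis
    then show False
      using assms(3) by blast
  qed
  then show ?thesis
    using eq[OF \<tau>] weil.int_pow_parity[OF parity Phi_carrier] by simp
qed

end

section \<open>Application to the given supercuspidal and special representations\<close>

lemma character_on_mult:
  assumes "character_on v F w H f"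
  shows "g \<in> H \<Longrightarrow> h \<in> H \<Longrightarrow> f (g \<otimes>\<^bsub>weil_group v F\<^esub> h) = f g * f h" "g \<in> H \<Longrightarrow> f g \<noteq> 0"
  using assms by (auto simp: character_on_def hom_def)

lemma weil_rep_mult:
  assumes "weil_rep v F w \<rho>" "g \<in> carrier (weil_group v F)" "h \<in> carrier (weil_group v F)"
  shows "\<rho> (g \<otimes>\<^bsub>weil_group v F\<^esub> h) = \<rho> g ** \<rho> h"
  using assms by (auto simp: weil_rep_def hom_def GL2_def)

theorem proposition3p10:
  fixes p l :: nat
    and Qp F E :: "'a::alg_closed_field set" and v :: "'a \<Rightarrow> real"
    and Ql K :: "'l::alg_closed_field set" and w :: "'l \<Rightarrow> real"
    and \<Phi> \<sigma> :: "'a \<Rightarrow> 'a"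
    and \<omega> t chi \<xi> :: "('a \<Rightarrow> 'a) \<Rightarrow> 'l"
    and \<rho>1 \<rho>2 :: "('a \<Rightarrow> 'a) \<Rightarrow> 'l^2^2"
    and a1 b1 d1 a2 b2 d2 :: 'l
    and red :: "'l \<Rightarrow> 'k::field"
  assumes "odd p" and "odd l" and "p \<noteq> l"
    and "padic_closure p Qp v" and "padic_closure l Ql w"
    and "finite_extension Qp F" and "finite_extension Ql K"
    and "frobenius_element v F \<Phi>"
    and "norm_character v F \<Phi> \<omega>"
    and "tame_character v F w Ql \<omega> t"
    and "reduction_map w K red"
    and "supercuspidal_of v F w \<Phi> t E \<sigma> \<xi> \<rho>1"
    and "special_of v F w \<Phi> t \<omega> chi \<rho>2"
    and "\<rho>1 ` carrier (weil_group v F) \<subseteq> GL2_over (val_ring w K)"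
    and "\<rho>2 ` carrier (weil_group v F) \<subseteq> GL2_over (val_ring w K)"
    and "mat2 a1 b1 0 d1 \<in> GL2_over K" and "mat2 a2 b2 0 d2 \<in> GL2_over K"
    and "\<And>k \<tau>. \<tau> \<in> inertia_group v F \<Longrightarrow>
      \<rho>1 (weil_elt v F \<Phi> k \<tau>) =
        mat2 a1 b1 0 d1 ** induced v F E \<sigma> \<xi> (weil_elt v F \<Phi> k \<tau>) ** matrix_inv (mat2 a1 b1 0 d1)"
    and "\<And>k \<tau>. \<tau> \<in> inertia_group v F \<Longrightarrow>
      \<rho>2 (weil_elt v F \<Phi> k \<tau>) =
        (let g = weil_elt v F \<Phi> k \<tau> in
         mat2 (chi g * \<omega> g) (a2 / d2 * t \<tau> * (chi g * \<omega> g) + b2 / d2 * (chi g - chi g * \<omega> g))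
              0          (chi g))"
    and "a2 / d2 \<in> units_in (val_ring w K)"
    and "unramified v F E"
  shows "reps_isomorphic (carrier (weil_group v F)) (reduce_rep red \<rho>1) (reduce_rep red \<rho>2) \<longleftrightarrow>
      indecomposable (carrier (weil_group v F)) (reduce_rep red \<rho>2) \<and>
      [int (residue_card v F) = - 1] (mod int l) \<and>
      (\<forall>h \<in> weil_subgroup v F E. red (chi h) = red (\<xi> h)) \<and>
      b1 \<noteq> 0 \<and> cong_val w K (chi \<sigma>) (- (a1 / b1)) \<and>
      (\<exists>x \<in> units_in (val_ring w K). \<forall>k. \<forall>\<tau> \<in> inertia_group v F.
         (let h = weil_elt v F \<Phi> k \<tau> in h \<in> weil_subgroup v F E \<longrightarrow>
           cong_val w K (a2 * x / d2 * t \<tau> * chi h)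
             (b1 / d1 * (conj_character v F \<sigma> \<xi> h - \<xi> h))))"
proof -
  have quadr: "quadratic_extension F E" and \<sigma>: "\<sigma> \<in> carrier (weil_group v F) - weil_subgroup v F E"
    and xi: "character_on v F w (weil_subgroup v F E) \<xi>" and rep1: "weil_rep v F w \<rho>1"
    using assms(12) by (auto simp: supercuspidal_of_def)
  have chi: "character_on v F w (carrier (weil_group v F)) chi" and rep2: "weil_rep v F w \<rho>2"
    using assms(13) by (auto simp: special_of_def)
  interpret P: padic_closure p Qp v by fact
  interpret L: padic_closure l Ql w by fact
  interpret F: subfield_type F
    using finite_extension_subfield[OF assms(6)] by simp
  interpret K: subfield_type K
    using finite_extension_subfield[OF assms(7)] by simp
  interpret WF: weil_frobenius p Qp v F \<Phi>
    by unfold_locales fact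
  interpret RR: residue_reduction w K red
    by unfold_locales fact
  let ?W = "weil_group v F" and ?H = "weil_subgroup v F E" and ?I = "inertia_group v F"
  define dec where "dec g s \<longleftrightarrow> (\<exists>k. \<exists>\<tau>\<in>?I. g = weil_elt v F \<Phi> k \<tau> \<and> s = t \<tau>)" for g s
  have dec_ex: "\<exists>s. dec g s" if "g \<in> carrier ?W" for g
    using WF.weil_elt_exhaust[OF that] unfolding dec_def by metis
  have dec_carrier: "g \<in> carrier ?W" if "dec g s" for g s
    using that WF.weil_elt_carrier by (auto simp: dec_def)
  note parity = WF.weil_subgroup_parity[OF assms(1) quadr \<sigma>]
  note elt_H = WF.weil_elt_parity[OF assms(1) quadr \<sigma> assms(21)]
  have \<omega>: "\<omega> (weil_elt v F \<Phi> k \<tau>) = of_nat (residue_card v F) powi (- k)" if "\<tau> \<in> ?I" for k \<tau>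
    using assms(9) that by (auto simp: norm_character_def)
  have t_img: "t ` ?I = val_ring w Ql"
    using assms(10) by (simp add: tame_character_def)
  have QK: "Ql \<subseteq> K"
    using finite_extension_subfield[OF assms(7)] by simp
  have U1: "a1 \<in> K" "b1 \<in> K" "d1 \<in> K" "a1 \<noteq> 0" "d1 \<noteq> 0"
    using assms(16) by (auto simp: mat2_GL2_over_iff units_in_def)
  have U2: "b2 \<in> K" "d2 \<in> K"
    using assms(17) by (auto simp: mat2_GL2_over_iff)
  have rho1: "\<rho>1 g = mat2 a1 b1 0 d1 ** induced v F E \<sigma> \<xi> g **
      mat2 (1 / a1) (- (b1 / (a1 * d1))) 0 (1 / d1)" if "g \<in> carrier ?W" for g
    using WF.weil_elt_exhaust[OF that] assms(18) matrix_inv_upper2[OF U1(4,5)] by metis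
  have H_W: "?H \<subseteq> carrier ?W"
    by (auto simp: weil_subgroup_def)
  have one_H: "\<one>\<^bsub>?W\<^esub> \<in> ?H"
    using parity[OF WF.weil.one_closed WF.weil.one_closed] by simp
  interpret R: residual_pair w K red ?W ?H \<sigma> \<Phi> chi \<omega> \<xi> \<rho>1 \<rho>2 dec a1 b1 d1 a2 b2 d2 "residue_card v F"
  proof unfold_locales
    show "?H \<subseteq> carrier ?W" by (fact H_W)
    show "g \<otimes>\<^bsub>?W\<^esub> h \<in> ?H \<longleftrightarrow> (g \<in> ?H \<longleftrightarrow> h \<in> ?H)" if "g \<in> carrier ?W" "h \<in> carrier ?W" for g h
      by (rule parity[OF that])
    show "\<sigma> \<in> carrier ?W" "\<sigma> \<notin> ?H" using \<sigma> by auto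
    show "\<Phi> \<in> carrier ?W" by (fact WF.Phi_carrier)
    show "\<Phi> \<notin> ?H" using elt_H[OF WF.id_inertia, of 1] by (simp add: WF.weil_elt_Phi)
    show "\<omega> \<Phi> = inverse (of_nat (residue_card v F))"
      using \<omega>[OF WF.id_inertia, of 1] by (simp add: WF.weil_elt_Phi power_int_minus)
    show "\<exists>k. \<omega> g = of_nat (residue_card v F) powi (- k) \<and> (g \<in> ?H \<longleftrightarrow> even k)"
      if "g \<in> carrier ?W" for g
      using WF.weil_elt_exhaust[OF that] \<omega> elt_H by metis
    show "chi (g \<otimes>\<^bsub>?W\<^esub> h) = chi g * chi h" if "g \<in> carrier ?W" "h \<in> carrier ?W" for g h
      by (rule character_on_mult(1)[OF chi that])
    show "\<xi> \<one>\<^bsub>?W\<^esub> = 1"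
      using character_on_mult(1)[OF xi one_H one_H] character_on_mult(2)[OF xi one_H] by simp
    show "\<rho>1 (g \<otimes>\<^bsub>?W\<^esub> h) = \<rho>1 g ** \<rho>1 h" "\<rho>2 (g \<otimes>\<^bsub>?W\<^esub> h) = \<rho>2 g ** \<rho>2 h"
      if "g \<in> carrier ?W" "h \<in> carrier ?W" for g h
      by (rule weil_rep_mult[OF rep1 that] weil_rep_mult[OF rep2 that])+
    show "\<rho>1 g \<in> GL2_over (val_ring w K)" "\<rho>2 g \<in> GL2_over (val_ring w K)"
      if "g \<in> carrier ?W" for g
      using assms(14,15) that by blast+
    show "\<rho>1 h = mat2 (\<xi> h)
        (b1 / d1 * (\<xi> (\<sigma> \<otimes>\<^bsub>?W\<^esub> h \<otimes>\<^bsub>?W\<^esub> inv\<^bsub>?W\<^esub> \<sigma>) - \<xi> h)) 0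
        (\<xi> (\<sigma> \<otimes>\<^bsub>?W\<^esub> h \<otimes>\<^bsub>?W\<^esub> inv\<^bsub>?W\<^esub> \<sigma>))" if "h \<in> ?H" for h
      using rho1[of h] that H_W U1
      by (auto simp: induced_def conj_character_def mat2_mult field_simps)
    show "\<rho>1 g = mat2 (b1 * y / a1)
        (a1 * \<xi> (g \<otimes>\<^bsub>?W\<^esub> inv\<^bsub>?W\<^esub> \<sigma>) / d1 - b1 * b1 * y / (a1 * d1)) (d1 * y / a1) (- (b1 * y / a1))"
      if "g \<in> carrier ?W" "g \<notin> ?H"
        "y = \<xi> (\<sigma> \<otimes>\<^bsub>?W\<^esub> (g \<otimes>\<^bsub>?W\<^esub> inv\<^bsub>?W\<^esub> \<sigma>) \<otimes>\<^bsub>?W\<^esub> \<sigma>)" for g y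
      using rho1[OF that(1)] that(2) U1
      by (simp add: induced_def Let_def mat2_mult field_simps flip: that(3))
    show "g \<in> carrier ?W" if "dec g s" for g s
      using that by (rule dec_carrier)
    show "s \<in> val_ring w K" if "dec g s" for g s
    proof -
      have "s \<in> val_ring w Ql"
        using that t_img by (auto simp: dec_def)
      then show ?thesis using QK by (auto simp: val_ring_def)
    qed
    show "\<exists>s. dec g s" if "g \<in> carrier ?W" for g
      using that by (rule dec_ex)
    \<comment> \<open>Surjectivity of \<open>t\<close> onto the l-adic integers provides an inertia
      element with value \<open>1\<close>; its Frobenius exponent \<open>0\<close> is even, and
      \<omega> is \<open>1\<close> there.\<close>
    show "\<exists>\<tau>\<in>?H. dec \<tau> 1 \<and> \<omega> \<tau> = 1"
    proof -
      have "1 \<in> val_ring w Ql"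
        using L.subfield_Q subfield_type.mem_1 by (auto simp: val_ring_def subfield_type_def)
      then obtain \<tau> where \<tau>: "\<tau> \<in> ?I" "t \<tau> = 1"
        using t_img by (metis imageE)
      show ?thesis
        using elt_H[OF \<tau>(1), of 0] \<omega>[OF \<tau>(1), of 0] \<tau>
        by (intro bexI[of _ \<tau>]) (auto simp: dec_def WF.weil_elt_inertia intro!: exI[of _ 0] bexI[of _ \<tau>])
    qed
    show "\<rho>2 g = mat2 (chi g * \<omega> g)
        (a2 / d2 * s * (chi g * \<omega> g) + b2 / d2 * (chi g - chi g * \<omega> g)) 0 (chi g)"
      if "dec g s" for g s
      using that assms(19) unfolding dec_def Let_def by blast
    \<comment> \<open>As \<open>l\<close> is odd, \<open>w 2 = 1\<close>, so \<open>2\<close>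
      survives reduction.\<close>
    show "(2 :: 'k) \<noteq> 0"
      using RR.red_of_nat[of 2] RR.red_nonzero_iff[OF RR.V_of_nat[of 2]] L.v_2[OF assms(2)] by simp
  qed (use assms U1 U2 in auto)
  \<comment> \<open>Both sides say that \<open>l\<close> divides \<open>q + 1\<close>, since a
    positive natural number reduces to zero exactly when \<open>l\<close> divides it.\<close>
  have q_iff: "red (of_nat (residue_card v F)) = - 1 \<longleftrightarrow> [int (residue_card v F) = - 1] (mod int l)"
    (is "red (of_nat ?q) = - 1 \<longleftrightarrow> _")
  proof -
    have "red (of_nat ?q) = - 1 \<longleftrightarrow> red (of_nat (Suc ?q)) = 0"
      by (simp only: RR.red_of_nat) (simp add: eq_neg_iff_add_eq_0 add.commute)
    also have "\<dots> \<longleftrightarrow> w (of_nat (Suc ?q)) < 1"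
      using RR.V_of_nat by (rule RR.red_0_iff)
    also have "\<dots> \<longleftrightarrow> l dvd Suc ?q"
      by (rule L.v_of_nat_less_1_iff) simp
    also have "\<dots> \<longleftrightarrow> int l dvd int ?q - (- 1)"
      by (metis diff_minus_eq_add int_dvd_int_iff int_ops(4) of_nat_1)
    finally show ?thesis
      by (simp add: cong_iff_dvd_diff)
  qed
  have x_iff: "R.x_condition x \<longleftrightarrow> (\<forall>k. \<forall>\<tau>\<in>?I.
      (let h = weil_elt v F \<Phi> k \<tau> in h \<in> ?H \<longrightarrow>
         cong_val w K (a2 * x / d2 * t \<tau> * chi h)
           (b1 / d1 * (conj_character v F \<sigma> \<xi> h - \<xi> h))))" for x
    unfolding R.x_condition_def dec_def Let_def conj_character_def by blast
  show ?thesis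
    unfolding R.iso_iff q_iff x_iff by blast
qed

end
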